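(* Assume that $z,w\in A_1$ and $[z,w]=1$. Assume that $z$ is a sum of not more than $2$ homogeneous elements of $A_1$. Then $z$ and $w$ generate $A_1$ (as a $K$-algebra).
   Context: $K$ is a field of characteristic $0$. $A_1$ is the first Weyl algebra over $K$, i.e. the associative unital $K$-algebra generated by $p,q$ subject to $pq-qp=1$; the elements $p^iq^j$ ($i,j\in\mathbb{Z}_{\ge0}$) form a $K$-basis. $[a,b]=ab-ba$. For $t\in\mathbb{Z}$, $D_t=\mathrm{Span}_K\{p^iq^s : i,s\ge 0,\ s-i=t\}$; an element of $A_1$ is homogeneous if it lies in $D_t$ for some $t\in\mathbb{Z}$. *)

theory Defs
  imports "HOL-Library.Poly_Mapping" "HOL-Computational_Algebra.Polynomial"
begin

text \<open>
  Words in two letters form the free monoid on them, written additively so that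
  finitely supported functions on words, with the convolution product of
  \<^theory>\<open>HOL-Library.Poly_Mapping\<close>, are the free associative unital algebra.
\<close>

datatype weyl_gen = Gen_p | Gen_q

datatype weyl_word = Wd (letters: "weyl_gen list")

instantiation weyl_word :: monoid_add
begin

definition "0 = Wd []"
definition "u + v = Wd (letters u @ letters v)"

instance
  by standard (auto simp: zero_weyl_word_def plus_weyl_word_def)

end

type_synonym 'k free_alg = "weyl_word \<Rightarrow>\<^sub>0 'k"

definition free_p :: "'k::field free_alg"
  where "free_p = Poly_Mapping.single (Wd [Gen_p]) 1"

definition free_q :: "'k::field free_alg"
  where "free_q = Poly_Mapping.single (Wd [Gen_q]) 1"

inductive_set weyl_ideal :: "'k::field free_alg set" where
  rel: "free_p * free_q - free_q * free_p - 1 \<in> weyl_ideal"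
| zero: "0 \<in> weyl_ideal"
| add: "a \<in> weyl_ideal \<Longrightarrow> b \<in> weyl_ideal \<Longrightarrow> a + b \<in> weyl_ideal"
| left: "a \<in> weyl_ideal \<Longrightarrow> r * a \<in> weyl_ideal"
| right: "a \<in> weyl_ideal \<Longrightarrow> a * r \<in> weyl_ideal"

lemma weyl_ideal_uminus: "a \<in> weyl_ideal \<Longrightarrow> - a \<in> weyl_ideal"
  using weyl_ideal.left[of a "- 1"] by simp

lemma weyl_ideal_diff: "a \<in> weyl_ideal \<Longrightarrow> b \<in> weyl_ideal \<Longrightarrow> a - b \<in> weyl_ideal"
  using weyl_ideal.add[of a "- b"] weyl_ideal_uminus[of b] by simp

text \<open>
  The free algebra acts on polynomials in one variable, with \<open>p\<close> acting as the derivative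
  and \<open>q\<close> as multiplication by the variable; the ideal acts as zero, hence is proper.
\<close>

fun letter_act :: "weyl_gen \<Rightarrow> 'k::field poly \<Rightarrow> 'k poly" where
  "letter_act Gen_p f = pderiv f"
| "letter_act Gen_q f = pCons 0 f"

definition word_act :: "weyl_word \<Rightarrow> 'k::field poly \<Rightarrow> 'k poly"
  where "word_act w f = foldr letter_act (letters w) f"

definition free_act :: "'k::field free_alg \<Rightarrow> 'k poly \<Rightarrow> 'k poly"
  where "free_act a f = (\<Sum>w\<in>Poly_Mapping.keys a. smult (Poly_Mapping.lookup a w) (word_act w f))"

lemma letter_act_add: "letter_act x (f + g) = letter_act x f + letter_act x g"
  by (cases x) (simp_all add: pderiv_add)

lemma letter_act_smult: "letter_act x (smult c f) = smult c (letter_act x f)"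
  by (cases x) (simp_all add: pderiv_smult)

lemma word_act_add: "word_act w (f + g) = word_act w f + word_act w g"
proof -
  have "foldr letter_act xs (f + g) = foldr letter_act xs f + foldr letter_act xs g" for xs
    by (induction xs) (simp_all add: letter_act_add)
  then show ?thesis by (simp add: word_act_def)
qed

lemma word_act_smult: "word_act w (smult c f) = smult c (word_act w f)"
proof -
  have "foldr letter_act xs (smult c f) = smult c (foldr letter_act xs f)" for xs
    by (induction xs) (simp_all add: letter_act_smult)
  then show ?thesis by (simp add: word_act_def)
qed

lemma word_act_plus: "word_act (u + v) f = word_act u (word_act v f)"
  by (simp add: word_act_def plus_weyl_word_def)

lemma free_act_superset:
  assumes "finite S" "Poly_Mapping.keys a \<subseteq> S"
  shows "free_act a f = (\<Sum>w\<in>S. smult (Poly_Mapping.lookup a w) (word_act w f))"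
  unfolding free_act_def
  by (rule sum.mono_neutral_left) (use assms in \<open>auto simp: in_keys_iff\<close>)

lemma free_act_single: "free_act (Poly_Mapping.single w c) f = smult c (word_act w f)"
  by (subst free_act_superset[of "{w}"]) auto

lemma free_act_0: "free_act 0 f = 0"
  by (simp add: free_act_def)

lemma free_act_add: "free_act (a + b) f = free_act a f + free_act b f"
proof -
  let ?S = "Poly_Mapping.keys a \<union> Poly_Mapping.keys b"
  have "free_act (a + b) f = (\<Sum>w\<in>?S. smult (Poly_Mapping.lookup (a + b) w) (word_act w f))"
    by (rule free_act_superset) (auto dest: Poly_Mapping.keys_add[THEN subsetD])
  also have "\<dots> = (\<Sum>w\<in>?S. smult (Poly_Mapping.lookup a w) (word_act w f))
      + (\<Sum>w\<in>?S. smult (Poly_Mapping.lookup b w) (word_act w f))"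
    by (simp add: lookup_add smult_add_left sum.distrib)
  also have "\<dots> = free_act a f + free_act b f"
    by (simp add: free_act_superset[of ?S])
  finally show ?thesis .
qed

lemma free_act_uminus: "free_act (- a) f = - free_act a f"
  using free_act_add[of a "- a" f] by (simp add: free_act_0 eq_neg_iff_add_eq_0 add.commute)

lemma free_act_diff: "free_act (a - b) f = free_act a f - free_act b f"
  using free_act_add[of a "- b" f] by (simp add: free_act_uminus)

lemma free_alg_induct [case_names zero single add]:
  assumes "P 0" "\<And>w c. P (Poly_Mapping.single w c)" "\<And>a b. P a \<Longrightarrow> P b \<Longrightarrow> P (a + b)"
  shows "P (a :: 'k::field free_alg)"
proof (induction a rule: update_induct)
  case const
  show ?case by (rule assms(1))
next
  case (update a w c)
  have "Poly_Mapping.update w c a = a + Poly_Mapping.single w c"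
    using update(1)
    by (intro poly_mapping_eqI)
      (auto simp: lookup_update lookup_add lookup_single when_def in_keys_iff)
  then show ?case using assms update by simp
qed

lemma free_act_vec_add: "free_act a (f + g) = free_act a f + free_act a g"
  by (simp add: free_act_def word_act_add smult_add_right sum.distrib)

lemma free_act_vec_0: "free_act a 0 = 0"
  using free_act_vec_add[of a 0 0] by (metis add.right_neutral add_left_cancel)

lemma free_act_mult: "free_act (a * b) f = free_act a (free_act b f)"
proof (induction a rule: free_alg_induct)
  case zero
  show ?case by (simp add: free_act_0)
next
  case (single w c)
  show ?case
    by (induction b rule: free_alg_induct)
      (simp_all add: free_act_0 free_act_vec_0 free_act_single mult_single word_act_plus
        word_act_smult free_act_add free_act_vec_add distrib_left)
next
  case (add a b)
  then show ?case by (simp add: free_act_add distrib_right)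
qed

lemma free_act_1: "free_act 1 f = f"
  by (simp flip: single_one add: free_act_single word_act_def zero_weyl_word_def)

lemma free_act_p: "free_act free_p f = pderiv f"
  by (simp add: free_p_def free_act_single word_act_def)

lemma free_act_q: "free_act free_q f = pCons 0 f"
  by (simp add: free_q_def free_act_single word_act_def)

lemma weyl_ideal_act: "a \<in> weyl_ideal \<Longrightarrow> free_act a f = 0"
  by (induction arbitrary: f rule: weyl_ideal.induct)
    (simp_all add: free_act_diff free_act_mult free_act_p free_act_q free_act_1 free_act_0
      free_act_add free_act_vec_0 pderiv_pCons)

lemma one_notin_weyl_ideal: "1 \<notin> weyl_ideal"
  using weyl_ideal_act[of 1 "1 :: 'k::field poly"] by (auto simp: free_act_1)

definition weyl_rel :: "'k::field free_alg \<Rightarrow> 'k free_alg \<Rightarrow> bool"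
  where "weyl_rel a b \<longleftrightarrow> a - b \<in> weyl_ideal"

lemma equivp_weyl_rel: "equivp weyl_rel"
proof (rule equivpI)
  show "reflp weyl_rel"
    by (simp add: reflp_def weyl_rel_def weyl_ideal.zero)
  show "symp weyl_rel"
    unfolding symp_def weyl_rel_def by (metis minus_diff_eq weyl_ideal_uminus)
  show "transp weyl_rel"
    unfolding transp_def weyl_rel_def
    by (metis weyl_ideal.add diff_add_cancel add_diff_eq)
qed

quotient_type (overloaded) 'k weyl = "'k::field free_alg" / weyl_rel
  by (rule equivp_weyl_rel)

instantiation weyl :: (field) ring_1
begin

lift_definition zero_weyl :: "'a weyl" is 0 .

lift_definition one_weyl :: "'a weyl" is 1 .

lift_definition plus_weyl :: "'a weyl \<Rightarrow> 'a weyl \<Rightarrow> 'a weyl" is "(+)"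
  unfolding weyl_rel_def using weyl_ideal.add by (metis add_diff_add)

lift_definition uminus_weyl :: "'a weyl \<Rightarrow> 'a weyl" is uminus
  unfolding weyl_rel_def using weyl_ideal_uminus by (metis minus_diff_minus)

lift_definition minus_weyl :: "'a weyl \<Rightarrow> 'a weyl \<Rightarrow> 'a weyl" is "(-)"
proof -
  fix a b c d :: "'a free_alg"
  assume "weyl_rel a b" "weyl_rel c d"
  then have "(a - b) - (c - d) \<in> weyl_ideal"
    unfolding weyl_rel_def by (rule weyl_ideal_diff)
  moreover have "(a - b) - (c - d) = (a - c) - (b - d)" by simp
  ultimately show "weyl_rel (a - c) (b - d)" unfolding weyl_rel_def by simp
qed

lift_definition times_weyl :: "'a weyl \<Rightarrow> 'a weyl \<Rightarrow> 'a weyl" is "(*)"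
proof -
  fix a b c d :: "'a free_alg"
  assume "weyl_rel a b" "weyl_rel c d"
  then have "(a - b) * c + b * (c - d) \<in> weyl_ideal"
    unfolding weyl_rel_def by (intro weyl_ideal.add weyl_ideal.left weyl_ideal.right)
  moreover have "(a - b) * c + b * (c - d) = a * c - b * d" by (simp add: algebra_simps)
  ultimately show "weyl_rel (a * c) (b * d)" unfolding weyl_rel_def by simp
qed

instance
proof
  fix a b c :: "'a weyl"
  show "a + b + c = a + (b + c)"
    by transfer (simp add: weyl_rel_def weyl_ideal.zero add.assoc)
  show "a + b = b + a"
    by transfer (simp add: weyl_rel_def weyl_ideal.zero add.commute)
  show "0 + a = a"
    by transfer (simp add: weyl_rel_def weyl_ideal.zero)
  show "- a + a = 0"
    by transfer (simp add: weyl_rel_def weyl_ideal.zero)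
  show "a - b = a + - b"
    by transfer (simp add: weyl_rel_def weyl_ideal.zero)
  show "a * b * c = a * (b * c)"
    by transfer (simp add: weyl_rel_def weyl_ideal.zero mult.assoc)
  show "1 * a = a" "a * 1 = a"
    by (transfer, simp add: weyl_rel_def weyl_ideal.zero)+
  show "(a + b) * c = a * c + b * c" "a * (b + c) = a * b + a * c"
    by (transfer, simp add: weyl_rel_def weyl_ideal.zero distrib_left distrib_right)+
  have "\<not> weyl_rel (0 :: 'a free_alg) 1"
    using one_notin_weyl_ideal weyl_ideal_uminus[of "- 1 :: 'a free_alg"]
    by (auto simp: weyl_rel_def)
  then show "(0 :: 'a weyl) \<noteq> 1"
    by transfer
qed

end

lift_definition weyl_p :: "'k::field weyl" is free_p .

lift_definition weyl_q :: "'k::field weyl" is free_q .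

lemma weyl_pq_relation: "weyl_p * weyl_q - weyl_q * weyl_p = 1"
  by transfer (simp add: weyl_rel_def weyl_ideal.rel)

lift_definition weyl_const :: "'k::field \<Rightarrow> 'k weyl" is "Poly_Mapping.single 0" .

definition weyl_scale :: "'k::field \<Rightarrow> 'k weyl \<Rightarrow> 'k weyl"
  where "weyl_scale c a = weyl_const c * a"

lemma weyl_const_add: "weyl_const (c + d) = weyl_const c + weyl_const d"
  by transfer (simp add: single_add weyl_rel_def weyl_ideal.zero)

lemma weyl_const_mult: "weyl_const (c * d) = weyl_const c * weyl_const d"
  by transfer (simp add: mult_single weyl_rel_def weyl_ideal.zero)

lemma weyl_const_1: "weyl_const 1 = 1"
  by transfer (simp add: weyl_rel_def weyl_ideal.zero)

lemma weyl_const_central: "weyl_const c * a = a * weyl_const c"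
proof transfer
  fix c :: "'k::field" and a :: "'k free_alg"
  have "Poly_Mapping.single 0 c * a = a * Poly_Mapping.single 0 c"
    by (induction a rule: free_alg_induct)
      (simp_all add: mult_single mult.commute distrib_left distrib_right)
  then show "weyl_rel (Poly_Mapping.single 0 c * a) (a * Poly_Mapping.single 0 c)"
    by (simp add: weyl_rel_def weyl_ideal.zero)
qed

interpretation weyl: vector_space weyl_scale
  by standard
    (simp_all add: weyl_scale_def weyl_const_add weyl_const_mult weyl_const_1
      distrib_left distrib_right mult.assoc)

lemma weyl_scale_mult_left: "weyl_scale c a * b = weyl_scale c (a * b)"
  by (simp add: weyl_scale_def mult.assoc)

lemma weyl_scale_mult_right: "a * weyl_scale c b = weyl_scale c (a * b)"
  by (metis weyl_scale_def weyl_const_central mult.assoc)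

definition commutator :: "'k::field weyl \<Rightarrow> 'k weyl \<Rightarrow> 'k weyl"
  where "commutator a b = a * b - b * a"

definition weyl_D :: "int \<Rightarrow> 'k::field weyl set"
  where "weyl_D t = weyl.span {weyl_p ^ i * weyl_q ^ s |i s. int s - int i = t}"

definition homogeneous :: "'k::field weyl \<Rightarrow> bool"
  where "homogeneous a \<longleftrightarrow> (\<exists>t. a \<in> weyl_D t)"

definition subalgebra :: "'k::field weyl set \<Rightarrow> bool"
  where "subalgebra B \<longleftrightarrow> weyl.subspace B \<and> 1 \<in> B \<and> (\<forall>a\<in>B. \<forall>b\<in>B. a * b \<in> B)"

definition generated_subalgebra :: "'k::field weyl set \<Rightarrow> 'k weyl set"
  where "generated_subalgebra S = subalgebra hull S"

end

theory Submission
  imports Defs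
begin

text \<open>
Let \<open>p\<close> act on polynomials in \<open>x\<close> as the derivative and \<open>q\<close> as multiplication by \<open>x\<close>. The part of
degree \<open>t\<close> of an element \<open>u\<close> of the Weyl algebra then sends \<open>x^n\<close> to \<open>F(n) x^(n+t)\<close> for a polynomial
\<open>F\<close>, the symbol of \<open>u\<close> in degree \<open>t\<close>. The symbols determine \<open>u\<close> (\<open>symbol_eq_imp\<close>), a product of
parts with symbols \<open>F\<close>, \<open>G\<close> in degrees \<open>s\<close>, \<open>t\<close> has the symbol \<open>F(X+t) G\<close> (\<open>symbol_mult\<close>), and since
there are no negative powers of \<open>x\<close>, a symbol in degree \<open>-i\<close> vanishes at \<open>0, ..., i-1\<close>. The last
point bounds degrees from below: \<open>\<bar>t\<bar> \<le> 2 deg F + t\<close> for \<open>F \<noteq> 0\<close> (\<open>symbol_size\<close>), with equality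
exactly for the scalar multiples of a power of \<open>p\<close> or of \<open>q\<close>.

If \<open>F\<close>, \<open>G\<close> have degrees \<open>i\<close>, \<open>j\<close> as polynomials, then the bracket of the corresponding homogeneous
elements has degree at most \<open>i+j-1\<close>, and its coefficient there is the product of the leading
coefficients times \<open>i t - j s\<close> (\<open>symbol_bracket_top\<close>). Everything rests on this Poisson bracket.

Let \<open>z\<close> have the two nonzero parts \<open>F\<close>, \<open>G\<close> in degrees \<open>a < b\<close>. In \<open>[z,w] = 1\<close> the parts of \<open>w\<close> in
the degrees \<open>(b-a) j - a\<close> interact only with each other: they are the rungs \<open>L j\<close> of a ladder, and
the brackets of \<open>F\<close> with \<open>L j\<close> and of \<open>G\<close> with \<open>L (j-1)\<close> add up to \<open>1\<close> for \<open>j = 0\<close> and to \<open>0\<close>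
otherwise. The ladder is finite, so it has a lowest and a highest rung.
\<^item> If the lowest rung has a nonzero bracket with \<open>F\<close>, this bracket is \<open>1\<close>. The leading
  coefficients of all rungs then follow by recursion and do not vanish, which would make the ladder
  infinite, unless \<open>a < 0 < b\<close> and both parts of \<open>z\<close> have the least possible size
  (\<open>endless_recursion\<close>, \<open>minimal_if_bottom_pair\<close>). The highest rung is treated by a symmetry that
  exchanges the two ends (\<open>mirror_ladder\<close>).
\<^item> Otherwise both extreme rungs commute with the neighbouring part of \<open>z\<close>. For \<open>0 \<le> a\<close> or \<open>b \<le> 0\<close>
  this is impossible because the degrees have the wrong signs, unless the part of \<open>z\<close> in degree \<open>0\<close>
  is a scalar; subtracting the scalar then leaves a single homogeneous part. For
  \<open>a < 0 < b\<close>, the leading coefficients along a line in the plane of pairs (rung, exponent) show that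
  the lowest rung has degree \<open>N a\<close> where \<open>N\<close> is the number of steps of the ladder, or that \<open>z\<close>
  again has least possible size (\<open>leading_form\<close>). In the first case the lowest rung is a
  scalar multiple of the lowest part of \<open>z^N\<close>, and subtracting that multiple of \<open>z^N\<close> from \<open>w\<close>
  shortens the ladder (\<open>minimal_size_by_descent\<close>).

The remaining case of least possible size comes with \<open>a = -1\<close> or \<open>b = 1\<close>. Hence \<open>z\<close> is
\<open>c p + d q^n\<close> or \<open>c q + d p^n\<close> with \<open>c \<noteq> 0\<close>, where \<open>n = 0\<close> accounts for a scalar part and \<open>d = 0\<close>
for a single homogeneous part. For such \<open>z\<close> a multiple of \<open>q\<close> or \<open>p\<close> is a partner that together
with \<open>z\<close> generates the algebra. Two partners of \<open>z\<close> differ by an element that commutes with \<open>z\<close>;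
once one partner generates together with \<open>z\<close>, such an element is a polynomial in \<open>z\<close>, so every
partner does (\<open>partner_generates\<close>).
\<close>

section \<open>Symbols of elements of the Weyl algebra\<close>

lemma weyl_induct [case_names one scale add mult_p mult_q]:
  fixes u :: "'k::field weyl"
  assumes one: "P 1"
    and scale: "\<And>c u. P u \<Longrightarrow> P (weyl_scale c u)"
    and add: "\<And>u v. P u \<Longrightarrow> P v \<Longrightarrow> P (u + v)"
    and mult_p: "\<And>u. P u \<Longrightarrow> P (weyl_p * u)"
    and mult_q: "\<And>u. P u \<Longrightarrow> P (weyl_q * u)"
  shows "P u"
proof -
  have word: "P (abs_weyl (Poly_Mapping.single (Wd xs) 1))" for xs
  proof (induction xs)
    case Nil
    have "abs_weyl (Poly_Mapping.single (Wd []) 1) = (1 :: 'k weyl)"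
      by (simp add: one_weyl.abs_eq flip: zero_weyl_word_def)
    then show ?case using one by simp
  next
    case (Cons x xs)
    show ?case
    proof (cases x)
      case Gen_p
      have "abs_weyl (Poly_Mapping.single (Wd (x # xs)) 1)
          = (weyl_p :: 'k weyl) * abs_weyl (Poly_Mapping.single (Wd xs) 1)"
        by (simp add: Gen_p weyl_p.abs_eq times_weyl.abs_eq free_p_def mult_single plus_weyl_word_def)
      then show ?thesis using mult_p[OF Cons] by simp
    next
      case Gen_q
      have "abs_weyl (Poly_Mapping.single (Wd (x # xs)) 1)
          = (weyl_q :: 'k weyl) * abs_weyl (Poly_Mapping.single (Wd xs) 1)"
        by (simp add: Gen_q weyl_q.abs_eq times_weyl.abs_eq free_q_def mult_single plus_weyl_word_def)
      then show ?thesis using mult_q[OF Cons] by simp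
    qed
  qed
  have "P (abs_weyl a)" for a :: "'k free_alg"
  proof (induction a rule: free_alg_induct)
    case zero
    have "abs_weyl 0 = weyl_scale 0 (1 :: 'k weyl)"
      by (simp add: zero_weyl.abs_eq)
    then show ?case using scale[OF one, of 0] by simp
  next
    case (single w c)
    have "abs_weyl (Poly_Mapping.single w c)
        = weyl_scale c (abs_weyl (Poly_Mapping.single w 1))"
      by (simp add: weyl_scale_def weyl_const.abs_eq times_weyl.abs_eq mult_single)
    then show ?case using scale word[of "letters w"] by simp
  next
    case (add a b)
    then show ?case using assms(3) by (simp add: plus_weyl.abs_eq flip: plus_weyl.abs_eq)
  qed
  moreover obtain a where "u = abs_weyl a"
    by (metis Quotient_weyl Quotient_abs_rep)
  ultimately show ?thesis by simp
qed

lift_definition weyl_act :: "'k::field weyl \<Rightarrow> 'k poly \<Rightarrow> 'k poly" is free_act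
proof
  fix a b :: "'k free_alg" and f
  assume "weyl_rel a b"
  then have "free_act (a - b) f = 0"
    unfolding weyl_rel_def by (rule weyl_ideal_act)
  then show "free_act a f = free_act b f"
    by (simp add: free_act_diff)
qed

lemma weyl_act_one: "weyl_act 1 f = f"
  by transfer (rule free_act_1)

lemma weyl_act_add: "weyl_act (u + v) f = weyl_act u f + weyl_act v f"
  by transfer (rule free_act_add)

lemma weyl_act_mult: "weyl_act (u * v) f = weyl_act u (weyl_act v f)"
  by transfer (rule free_act_mult)

lemma weyl_act_p: "weyl_act weyl_p f = pderiv f"
  by transfer (rule free_act_p)

lemma weyl_act_q: "weyl_act weyl_q f = pCons 0 f"
  by transfer (rule free_act_q)

lemma weyl_act_scale: "weyl_act (weyl_scale c u) f = smult c (weyl_act u f)"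
proof -
  have "weyl_act (weyl_const c) f = smult c f" for f
    by transfer (simp add: free_act_single word_act_def zero_weyl_word_def)
  then show ?thesis by (simp add: weyl_scale_def weyl_act_mult)
qed

text \<open>
For \<open>n + t < 0\<close> there is no monomial \<open>x^(n+t)\<close> whose coefficient could record the value of \<open>S t\<close> at
\<open>n\<close>, so its vanishing is a separate condition. Left multiplication by \<open>q\<close> relies on it: no coefficient
is moved to the exponent \<open>0\<close>.
\<close>

definition is_symbol :: "'k::field_char_0 weyl \<Rightarrow> (int \<Rightarrow> 'k poly) \<Rightarrow> bool" where
  "is_symbol u S \<longleftrightarrow> finite {t. S t \<noteq> 0}
     \<and> (\<forall>n k. coeff (weyl_act u (monom 1 n)) k = poly (S (int k - int n)) (of_nat n))
     \<and> (\<forall>n t. int n + t < 0 \<longrightarrow> poly (S t) (of_nat n) = 0)"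

lemma is_symbol_finite: "is_symbol u S \<Longrightarrow> finite {t. S t \<noteq> 0}"
  unfolding is_symbol_def by (rule conjunct1)

lemma is_symbol_coeff:
  assumes "is_symbol u S" "int k = int n + t"
  shows "coeff (weyl_act u (monom 1 n)) k = poly (S t) (of_nat n)"
proof -
  have "t = int k - int n" using assms(2) by simp
  then show ?thesis using assms(1) by (simp only: is_symbol_def)
qed

lemma is_symbol_root:
  assumes "is_symbol u S" "int n + t < 0"
  shows "poly (S t) (of_nat n) = 0"
  using assms by (simp only: is_symbol_def)

lemma is_symbol_one: "is_symbol 1 (\<lambda>t. if t = 0 then 1 else 0)"
  unfolding is_symbol_def by (auto simp: weyl_act_one)

lemma is_symbol_add:
  assumes S: "is_symbol u S" and T: "is_symbol v T"
  shows "is_symbol (u + v) (\<lambda>t. S t + T t)"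
  unfolding is_symbol_def
proof (intro conjI allI impI)
  have "{t. S t + T t \<noteq> 0} \<subseteq> {t. S t \<noteq> 0} \<union> {t. T t \<noteq> 0}" by auto
  then show "finite {t. S t + T t \<noteq> 0}"
    using is_symbol_finite[OF S] is_symbol_finite[OF T] finite_subset by blast
next
  fix n k
  show "coeff (weyl_act (u + v) (monom 1 n)) k
      = poly (S (int k - int n) + T (int k - int n)) (of_nat n)"
    using is_symbol_coeff[OF S, of k n "int k - int n"] is_symbol_coeff[OF T, of k n "int k - int n"]
    by (simp add: weyl_act_add)
next
  fix n :: nat and t :: int
  assume "int n + t < 0"
  then show "poly (S t + T t) (of_nat n) = 0"
    using is_symbol_root[OF S] is_symbol_root[OF T] by simp
qed

lemma is_symbol_scale:
  assumes S: "is_symbol u S"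
  shows "is_symbol (weyl_scale c u) (\<lambda>t. smult c (S t))"
  unfolding is_symbol_def
proof (intro conjI allI impI)
  have "{t. smult c (S t) \<noteq> 0} \<subseteq> {t. S t \<noteq> 0}" by auto
  then show "finite {t. smult c (S t) \<noteq> 0}"
    using is_symbol_finite[OF S] finite_subset by blast
next
  fix n k
  show "coeff (weyl_act (weyl_scale c u) (monom 1 n)) k
      = poly (smult c (S (int k - int n))) (of_nat n)"
    using is_symbol_coeff[OF S, of k n "int k - int n"] by (simp add: weyl_act_scale)
next
  fix n :: nat and t :: int
  assume "int n + t < 0"
  then show "poly (smult c (S t)) (of_nat n) = 0"
    using is_symbol_root[OF S] by simp
qed

lemma is_symbol_mult_p:
  assumes "is_symbol u S"
  shows "is_symbol (weyl_p * u) (\<lambda>t. [:of_int (t + 1), 1:] * S (t + 1))"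
  unfolding is_symbol_def
proof (intro conjI allI impI)
  have "t \<in> (\<lambda>t. t - 1) ` {t. S t \<noteq> 0}" if "S (t + 1) \<noteq> 0" for t
    using that by (intro image_eqI[of _ _ "t + 1"]) auto
  moreover have "S (t + 1) \<noteq> 0" if "[:of_int (t + 1), 1:] * S (t + 1) \<noteq> 0" for t
    using that by (metis mult_zero_right)
  ultimately have "{t. [:of_int (t + 1), 1:] * S (t + 1) \<noteq> 0} \<subseteq> (\<lambda>t. t - 1) ` {t. S t \<noteq> 0}"
    by blast
  moreover have "finite {t. S t \<noteq> 0}" by (rule is_symbol_finite[OF assms])
  ultimately show "finite {t. [:of_int (t + 1), 1:] * S (t + 1) \<noteq> 0}"
    by (rule finite_subset[OF _ finite_imageI])
next
  fix n k
  have "coeff (weyl_act (weyl_p * u) (monom 1 n)) k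
      = of_nat (Suc k) * coeff (weyl_act u (monom 1 n)) (Suc k)"
    by (simp add: weyl_act_mult weyl_act_p coeff_pderiv)
  also have "coeff (weyl_act u (monom 1 n)) (Suc k) = poly (S (int k - int n + 1)) (of_nat n)"
    by (rule is_symbol_coeff[OF assms]) simp
  finally show "coeff (weyl_act (weyl_p * u) (monom 1 n)) k
      = poly ([:of_int (int k - int n + 1), 1:] * S (int k - int n + 1)) (of_nat n)"
    by (simp add: algebra_simps)
next
  fix n :: nat and t :: int
  assume neg: "int n + t < 0"
  show "poly ([:of_int (t + 1), 1:] * S (t + 1)) (of_nat n) = 0"
  proof (cases "int n + (t + 1) = 0")
    case True
    then have "(of_int (t + 1) :: 'a) + of_nat n = of_int 0"
      by (metis add.commute of_int_add of_int_of_nat_eq)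
    then have "poly [:of_int (t + 1), 1:] (of_nat n :: 'a) = 0" by simp
    then show ?thesis by (simp only: poly_mult mult_zero_left)
  next
    case False
    with neg have "int n + (t + 1) < 0" by simp
    then show ?thesis using is_symbol_root[OF assms] by simp
  qed
qed

lemma is_symbol_mult_q:
  assumes "is_symbol u S"
  shows "is_symbol (weyl_q * u) (\<lambda>t. S (t - 1))"
  unfolding is_symbol_def
proof (intro conjI allI impI)
  have "{t. S (t - 1) \<noteq> 0} \<subseteq> (\<lambda>t. t + 1) ` {t. S t \<noteq> 0}"
    by (force simp: image_iff)
  moreover have "finite {t. S t \<noteq> 0}" by (rule is_symbol_finite[OF assms])
  ultimately show "finite {t. S (t - 1) \<noteq> 0}"
    by (rule finite_subset[OF _ finite_imageI])
next
  fix n k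
  show "coeff (weyl_act (weyl_q * u) (monom 1 n)) k = poly (S (int k - int n - 1)) (of_nat n)"
  proof (cases k)
    case 0
    then show ?thesis using is_symbol_root[OF assms, of n "- int n - 1"]
      by (simp add: weyl_act_mult weyl_act_q)
  next
    case (Suc j)
    then have "coeff (weyl_act (weyl_q * u) (monom 1 n)) k = coeff (weyl_act u (monom 1 n)) j"
      by (simp add: weyl_act_mult weyl_act_q)
    also have "\<dots> = poly (S (int k - int n - 1)) (of_nat n)"
      by (rule is_symbol_coeff[OF assms]) (simp add: Suc)
    finally show ?thesis .
  qed
next
  fix n :: nat and t :: int
  assume "int n + t < 0"
  then show "poly (S (t - 1)) (of_nat n) = 0" using is_symbol_root[OF assms] by simp
qed

lemma is_symbol_exists: "\<exists>S. is_symbol u S"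
proof (induction u rule: weyl_induct)
  case one
  show ?case by (rule exI, rule is_symbol_one)
next
  case (scale c u)
  then show ?case by (elim exE) (rule exI, rule is_symbol_scale)
next
  case (add u v)
  then show ?case by (elim exE) (rule exI, rule is_symbol_add)
next
  case (mult_p u)
  then show ?case by (elim exE) (rule exI, rule is_symbol_mult_p)
next
  case (mult_q u)
  then show ?case by (elim exE) (rule exI, rule is_symbol_mult_q)
qed

text \<open>
Two symbols agree at all natural numbers from \<open>-t\<close> on, and these are infinitely many points in
characteristic \<open>0\<close>.
\<close>

lemma is_symbol_unique:
  assumes "is_symbol u S" "is_symbol u T"
  shows "S = T"
proof
  fix t
  have eq: "poly (S t - T t) (of_nat n) = 0" if "n \<ge> nat (- t)" for n
  proof -
    have "- t \<le> int n" using that by (simp add: nat_le_iff)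
    then obtain k where k: "int k = int n + t"
      using that[of "nat (int n + t)"] by simp
    show ?thesis
      using is_symbol_coeff[OF assms(1) k] is_symbol_coeff[OF assms(2) k] by simp
  qed
  have "infinite ((of_nat :: nat \<Rightarrow> 'a) ` {nat (- t)..})"
    using infinite_Ici finite_imageD[OF _ inj_on_subset[OF inj_of_nat subset_UNIV]] by blast
  moreover have "(of_nat :: nat \<Rightarrow> 'a) ` {nat (- t)..} \<subseteq> {x. poly (S t - T t) x = 0}"
    using eq by auto
  ultimately have "S t - T t = 0"
    using poly_roots_finite finite_subset by blast
  then show "S t = T t" by simp
qed

definition weyl_symbol :: "'k::field_char_0 weyl \<Rightarrow> int \<Rightarrow> 'k poly" where
  "weyl_symbol u = (THE S. is_symbol u S)"

lemma is_symbol_weyl_symbol: "is_symbol u (weyl_symbol u)"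
  unfolding weyl_symbol_def
proof (rule theI'[of "is_symbol u"])
  show "\<exists>!S. is_symbol u S"
    using is_symbol_exists[of u] is_symbol_unique[of u] by (intro ex_ex1I) auto
qed

lemma symbol_eqI:
  assumes "is_symbol u S"
  shows "weyl_symbol u t = S t"
  by (simp only: is_symbol_unique[OF is_symbol_weyl_symbol assms])

lemma symbol_one: "weyl_symbol 1 t = (if t = 0 then 1 else 0)"
  by (simp only: symbol_eqI[OF is_symbol_one])

lemma symbol_add: "weyl_symbol (u + v) t = weyl_symbol u t + weyl_symbol v t"
  by (simp only: symbol_eqI[OF is_symbol_add[OF is_symbol_weyl_symbol is_symbol_weyl_symbol]])

lemma symbol_scale: "weyl_symbol (weyl_scale c u) t = smult c (weyl_symbol u t)"
  by (simp only: symbol_eqI[OF is_symbol_scale[OF is_symbol_weyl_symbol]])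

lemma symbol_mult_p:
  "weyl_symbol (weyl_p * u) t = [:of_int (t + 1), 1:] * weyl_symbol u (t + 1)"
  by (simp only: symbol_eqI[OF is_symbol_mult_p[OF is_symbol_weyl_symbol]])

lemma symbol_mult_q: "weyl_symbol (weyl_q * u) t = weyl_symbol u (t - 1)"
  by (simp only: symbol_eqI[OF is_symbol_mult_q[OF is_symbol_weyl_symbol]])

lemma finite_symbol: "finite {t. weyl_symbol u t \<noteq> 0}"
  by (rule is_symbol_finite[OF is_symbol_weyl_symbol])

lemma symbol_root: "int n + t < 0 \<Longrightarrow> poly (weyl_symbol u t) (of_nat n) = 0"
  by (rule is_symbol_root[OF is_symbol_weyl_symbol])

lemma symbol_zero: "weyl_symbol 0 t = 0"
  using symbol_add[of 0 0 t] by simp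

lemma symbol_diff: "weyl_symbol (u - v) t = weyl_symbol u t - weyl_symbol v t"
  using symbol_add[of "u - v" v t] by simp

text \<open>
A symbol in degree \<open>-i\<close> has the \<open>i\<close> roots \<open>0, ..., i-1\<close>.
\<close>

lemma symbol_degree:
  assumes "weyl_symbol u t \<noteq> 0"
  shows "- t \<le> int (degree (weyl_symbol u t))"
proof -
  let ?F = "weyl_symbol u t"
  have "(of_nat :: nat \<Rightarrow> 'a) ` {..<nat (- t)} \<subseteq> {x. poly ?F x = 0}"
    by (auto intro!: symbol_root)
  then have "card ((of_nat :: nat \<Rightarrow> 'a) ` {..<nat (- t)}) \<le> card {x. poly ?F x = 0}"
    using poly_roots_finite[OF assms] card_mono by blast
  also have "\<dots> \<le> degree ?F" by (rule card_poly_roots_bound[OF assms])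
  finally show ?thesis by (simp add: card_image inj_on_def)
qed

definition translate :: "int \<Rightarrow> 'k::field_char_0 poly \<Rightarrow> 'k poly" where
  "translate s F = pcompose F [:of_int s, 1:]"

lemma translate_add: "translate s (F + G) = translate s F + translate s G"
  by (simp add: translate_def pcompose_add)

lemma translate_diff: "translate s (F - G) = translate s F - translate s G"
  by (simp add: translate_def pcompose_diff)

lemma translate_smult: "translate s (smult c F) = smult c (translate s F)"
  by (simp add: translate_def pcompose_smult)

lemma translate_mult: "translate s (F * G) = translate s F * translate s G"
  by (simp add: translate_def pcompose_mult)

lemma translate_zero [simp]: "translate s 0 = 0"
  by (simp add: translate_def)

lemma translate_one [simp]: "translate s 1 = 1"
  by (simp add: translate_def pcompose_1)

lemma translate_eq_0_iff [simp]: "translate s F = 0 \<longleftrightarrow> F = 0"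
  by (simp add: translate_def pcompose_eq_0_iff)

lemma translate_pCons: "translate s (pCons c F) = [:c:] + [:of_int s, 1:] * translate s F"
  by (simp add: translate_def pcompose_pCons)

text \<open>
Applying the part of degree \<open>s\<close> of \<open>v\<close> first moves \<open>x^n\<close> to \<open>x^(n+s)\<close>, so the symbol of \<open>u\<close> is
evaluated at \<open>n+s\<close>. The induction on \<open>u\<close> only needs the two rules for multiplication by a generator.
\<close>

lemma symbol_mult:
  "weyl_symbol (u * v) t
    = (\<Sum>s | weyl_symbol v s \<noteq> 0. translate s (weyl_symbol u (t - s)) * weyl_symbol v s)"
proof (induction u arbitrary: t rule: weyl_induct)
  case one
  have "(\<Sum>s | weyl_symbol v s \<noteq> 0. translate s (weyl_symbol 1 (t - s)) * weyl_symbol v s)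
      = (\<Sum>s | weyl_symbol v s \<noteq> 0. if s = t then weyl_symbol v s else 0)"
    by (rule sum.cong) (auto simp: symbol_one)
  also have "\<dots> = weyl_symbol v t"
    using finite_symbol[of v] by simp
  finally show ?case by simp
next
  case (scale c u)
  have "smult c (\<Sum>s\<in>A. f s) = (\<Sum>s\<in>A. smult c (f s))" for A and f :: "int \<Rightarrow> 'a poly"
    by (induction A rule: infinite_finite_induct) (simp_all add: smult_add_right)
  then show ?case
    by (simp add: weyl_scale_mult_left symbol_scale translate_smult scale)
next
  case (add u u')
  then show ?case
    by (simp add: distrib_right symbol_add translate_add sum.distrib)
next
  case (mult_p u)
  have "translate s ([:of_int (t - s + 1), 1:] * weyl_symbol u (t - s + 1)) * weyl_symbol v s
      = [:of_int (t + 1), 1:] * (translate s (weyl_symbol u (t + 1 - s)) * weyl_symbol v s)" for s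
  proof -
    have "translate s [:of_int (t - s + 1), 1:] = [:of_int (t + 1), 1 :: 'a:]"
      by (simp add: translate_pCons)
    moreover have "t - s + 1 = t + 1 - s" by simp
    ultimately show ?thesis by (simp only: translate_mult mult.assoc)
  qed
  then show ?case
    by (simp only: mult.assoc symbol_mult_p mult_p sum_distrib_left)
next
  case (mult_q u)
  have "t - s - 1 = t - 1 - s" for s by simp
  then show ?case
    by (simp only: mult.assoc symbol_mult_q mult_q)
qed

section \<open>Faithfulness of the symbol\<close>

lemma commutator_power:
  assumes "commutator z v = 1"
  shows "z * v ^ i = v ^ i * z + weyl_scale (of_nat i) (v ^ (i - 1))"
proof (induction i)
  case 0
  then show ?case by simp
next
  case (Suc i)
  have zv: "z * v = v * z + 1" using assms by (simp add: commutator_def algebra_simps)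
  have *: "v * weyl_scale (of_nat i) (v ^ (i - 1)) = weyl_scale (of_nat i) (v ^ i)"
    by (cases i) (simp_all add: weyl_scale_mult_right del: of_nat_Suc)
  have "z * v ^ Suc i = v * (z * v ^ i) + v ^ i"
    using zv by (simp add: distrib_right flip: mult.assoc)
  also have "\<dots> = v ^ Suc i * z + (weyl_scale (of_nat i) (v ^ i) + v ^ i)"
    unfolding Suc distrib_left * by (simp add: add.assoc mult.assoc)
  also have "weyl_scale (of_nat i) (v ^ i) + v ^ i = weyl_scale (of_nat (Suc i)) (v ^ i)"
    by (simp add: weyl.scale_left_distrib)
  finally show ?case by simp
qed

lemma weyl_span_mult_left:
  fixes r x :: "'k::field weyl"
  assumes x: "x \<in> weyl.span B" and B: "\<And>y. y \<in> B \<Longrightarrow> r * y \<in> weyl.span B"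
  shows "r * x \<in> weyl.span B"
proof -
  have "weyl.subspace {y. r * y \<in> weyl.span B}"
    unfolding weyl.subspace_def
    by (auto simp: distrib_left weyl_scale_mult_right weyl.span_zero weyl.span_add weyl.span_scale)
  then show ?thesis using weyl.span_minimal[of B "{y. r * y \<in> weyl.span B}"] x B by blast
qed

lemma weyl_normal_form: "u \<in> weyl.span {weyl_q ^ j * weyl_p ^ i |i j. True}"
proof (induction u rule: weyl_induct)
  let ?B = "{weyl_q ^ j * weyl_p ^ i |i j. True} :: 'a weyl set"
  have B: "weyl_q ^ j * weyl_p ^ i \<in> weyl.span ?B" for i j
    by (rule weyl.span_base) blast
  {
    case one
    show ?case using B[of 0 0] by simp
  next
    case (scale c u)
    then show ?case by (rule weyl.span_scale)
  next
    case (add u v)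
    then show ?case by (rule weyl.span_add)
  next
    case (mult_p u)
    then show ?case
    proof (rule weyl_span_mult_left)
      fix y :: "'a weyl" assume "y \<in> ?B"
      then obtain i j where y: "y = weyl_q ^ j * weyl_p ^ i" by blast
      have "commutator weyl_p weyl_q = (1 :: 'a weyl)"
        unfolding commutator_def by (rule weyl_pq_relation)
      then have "weyl_p * y
          = weyl_q ^ j * weyl_p ^ Suc i + weyl_scale (of_nat j) (weyl_q ^ (j - 1) * weyl_p ^ i)"
        by (simp add: y commutator_power distrib_right weyl_scale_mult_left flip: mult.assoc)
      then show "weyl_p * y \<in> weyl.span ?B"
        using B weyl.span_add weyl.span_scale by metis
    qed
  next
    case (mult_q u)
    then show ?case
    proof (rule weyl_span_mult_left)
      fix y :: "'a weyl" assume "y \<in> ?B"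
      then obtain i j where y: "y = weyl_q ^ j * weyl_p ^ i" by blast
      then show "weyl_q * y \<in> weyl.span ?B" using B[of "Suc j" i] by (simp add: mult.assoc)
    qed
  }
qed

lemma symbol_q_power_mult: "weyl_symbol (weyl_q ^ j * u) t = weyl_symbol u (t - int j)"
  by (induction j arbitrary: t) (simp_all add: mult.assoc symbol_mult_q algebra_simps)

lemma symbol_p_power:
  "weyl_symbol (weyl_p ^ i) t = (if t = - int i then \<Prod>m<i. [:- of_nat m, 1:] else 0)"
proof (induction i arbitrary: t)
  case 0
  then show ?case by (simp add: symbol_one)
next
  case (Suc i)
  have "weyl_symbol (weyl_p ^ Suc i :: 'a weyl) t = [:of_int (t + 1), 1:] * weyl_symbol (weyl_p ^ i) (t + 1)"
    by (simp add: symbol_mult_p)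
  also have "\<dots> = (if t = - int (Suc i) then [:- of_nat i, 1:] * (\<Prod>m<i. [:- of_nat m, 1:]) else 0)"
    unfolding Suc by auto
  finally show ?case by (simp add: mult.commute)
qed

lemma falling_product:
  fixes i :: nat
  defines "f \<equiv> \<Prod>m<i. [:- of_nat m, 1 :: 'k::field_char_0:]"
  shows "degree f = i" "coeff f i = 1"
proof -
  show deg: "degree f = i"
    unfolding f_def by (subst degree_prod_eq_sum_degree) auto
  have "lead_coeff f = 1" unfolding f_def by (simp add: lead_coeff_prod)
  then show "coeff f i = 1" using deg by simp
qed

lemma symbol_sum: "weyl_symbol (\<Sum>x\<in>A. g x) t = (\<Sum>x\<in>A. weyl_symbol (g x) t)"
  by (induction A rule: infinite_finite_induct) (simp_all add: symbol_zero symbol_add)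

text \<open>
The symbol of \<open>q^j p^i\<close> is \<open>X (X-1) ... (X-i+1)\<close> in the single degree \<open>j-i\<close>. In a combination of
such monomials, one with the largest \<open>i\<close> is therefore the only one that contributes to the
coefficient of \<open>X^i\<close> in its degree.
\<close>

lemma symbol_eq_0_imp:
  fixes u :: "'k::field_char_0 weyl"
  assumes zero: "\<And>t. weyl_symbol u t = 0"
  shows "u = 0"
proof -
  obtain A r where A: "finite A" "A \<subseteq> {weyl_q ^ j * weyl_p ^ i |i j. True}"
      and u: "u = (\<Sum>x\<in>A. weyl_scale (r x) x)"
    using weyl_normal_form[of u] unfolding weyl.span_explicit by auto
  then have "\<forall>x\<in>A. \<exists>i j. x = weyl_q ^ j * weyl_p ^ i" by blast
  then obtain I J where IJ: "\<And>x. x \<in> A \<Longrightarrow> x = weyl_q ^ J x * weyl_p ^ I x" by metis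
  have sym: "weyl_symbol x t
      = (if t = int (J x) - int (I x) then \<Prod>m<I x. [:- of_nat m, 1:] else 0)" if "x \<in> A" for x t
  proof -
    have "weyl_symbol x t = weyl_symbol (weyl_q ^ J x * weyl_p ^ I x) t"
      using IJ[OF that] by simp
    then show ?thesis by (auto simp: symbol_q_power_mult symbol_p_power)
  qed
  define A' where "A' = {x \<in> A. r x \<noteq> 0}"
  have "A' = {}"
  proof (rule ccontr)
    assume "A' \<noteq> {}"
    moreover have "finite A'" using A by (simp add: A'_def)
    ultimately have "Max (I ` A') \<in> I ` A'" and ge: "\<And>y. y \<in> A' \<Longrightarrow> I y \<le> Max (I ` A')"
      by (auto intro!: Max_in)
    then obtain x where x: "x \<in> A'" and "I x = Max (I ` A')" by auto
    with ge have max: "\<And>y. y \<in> A' \<Longrightarrow> I y \<le> I x" by simp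
    let ?t = "int (J x) - int (I x)"
    have term_eq: "coeff (smult (r y) (weyl_symbol y ?t)) (I x) = (if y = x then r x else 0)"
      if y: "y \<in> A" for y
    proof (cases "r y = 0 \<or> int (J y) - int (I y) \<noteq> ?t")
      case True
      then show ?thesis using x sym[OF y] by (auto simp: A'_def)
    next
      case False
      then have le: "I y \<le> I x" and t: "int (J y) - int (I y) = ?t"
        using max[of y] y by (auto simp: A'_def)
      show ?thesis
      proof (cases "I y = I x")
        case True
        then have "y = x" using IJ[OF y] IJ[of x] x t by (auto simp: A'_def)
        then show ?thesis using sym[OF y] by (simp add: falling_product)
      next
        case False
        then have "coeff (weyl_symbol y ?t) (I x) = 0"
          using sym[OF y, of ?t] t le by (simp add: coeff_eq_0 falling_product)
        then show ?thesis using False by auto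
      qed
    qed
    have "coeff (weyl_symbol u ?t) (I x) = (\<Sum>y\<in>A. if y = x then r x else 0)"
      unfolding u symbol_sum symbol_scale coeff_sum
      by (rule sum.cong[OF refl]) (rule term_eq)
    also have "\<dots> = r x" using A x by (simp add: A'_def)
    finally show False using x zero by (simp add: A'_def)
  qed
  then show "u = 0" unfolding u by (intro sum.neutral) (auto simp: A'_def)
qed

lemma symbol_eq_imp:
  assumes "\<And>t. weyl_symbol u t = weyl_symbol v t"
  shows "u = v"
  using symbol_eq_0_imp[of "u - v"] assms by (simp add: symbol_diff)

lemma symbol_weyl_D:
  assumes "u \<in> weyl_D d" "t \<noteq> d"
  shows "weyl_symbol u t = 0"
proof -
  have base: "weyl_symbol (weyl_p ^ i * weyl_q ^ s) t = 0" if "t \<noteq> int s - int i" for i s t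
    using that
  proof (induction i arbitrary: t)
    case 0
    then show ?case using symbol_q_power_mult[of s 1 t] by (simp add: symbol_one)
  next
    case (Suc i)
    then show ?case by (simp add: mult.assoc symbol_mult_p)
  qed
  have "weyl.subspace {u :: 'a weyl. weyl_symbol u t = 0}"
    unfolding weyl.subspace_def by (simp add: symbol_zero symbol_add symbol_scale)
  then have "weyl_D d \<subseteq> {u :: 'a weyl. weyl_symbol u t = 0}"
    unfolding weyl_D_def using base assms(2) by (intro weyl.span_minimal) auto
  then show ?thesis using assms(1) by blast
qed

lemma symbol_size: "weyl_symbol u t \<noteq> 0 \<Longrightarrow> \<bar>t\<bar> \<le> 2 * int (degree (weyl_symbol u t)) + t"
  using symbol_degree[of u t] by linarith

text \<open>
Up to scalars, the only homogeneous element of degree \<open>t\<close> for which the bound \<open>symbol_size\<close> is an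
equality.
\<close>

definition extreme_monomial :: "int \<Rightarrow> 'k::field_char_0 weyl" where
  "extreme_monomial t = (if 0 \<le> t then weyl_q ^ nat t else weyl_p ^ nat (- t))"

lemma symbol_extreme_monomial: "s \<noteq> t \<Longrightarrow> weyl_symbol (extreme_monomial t) s = 0"
  using symbol_q_power_mult[of "nat t" 1 s]
  by (auto simp: extreme_monomial_def symbol_p_power symbol_one)

text \<open>
In degree \<open>-i\<close>, a polynomial of degree \<open>i\<close> with the roots \<open>0, ..., i-1\<close> is determined up to a scalar.
\<close>

lemma symbol_of_minimal_size:
  fixes u :: "'k::field_char_0 weyl"
  assumes "2 * int (degree (weyl_symbol u t)) + t \<le> \<bar>t\<bar>"
  shows "\<exists>c. weyl_symbol u t = smult c (weyl_symbol (extreme_monomial t) t)"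
proof (cases "0 \<le> t")
  case True
  then have "degree (weyl_symbol u t) = 0" using assms by simp
  then obtain c where "weyl_symbol u t = [:c:]" by (rule degree_eq_zeroE)
  moreover have "weyl_symbol (extreme_monomial t) t = (1 :: 'k poly)"
    using True symbol_q_power_mult[of "nat t" 1 t] by (simp add: extreme_monomial_def symbol_one)
  ultimately show ?thesis by (intro exI[of _ c]) simp
next
  case False
  define i where "i = nat (- t)"
  have t: "t = - int i" and i: "0 < i" using False by (simp_all add: i_def)
  let ?F = "weyl_symbol u t" and ?E = "weyl_symbol (extreme_monomial t) t :: 'k poly"
  have "?E = (\<Prod>m<i. [:- of_nat m, 1:])"
    using False by (simp add: extreme_monomial_def symbol_p_power i_def)
  then have E: "degree ?E = i" "coeff ?E i = 1" by (simp_all add: falling_product)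
  have F: "degree ?F \<le> i" using assms t by simp
  define H where "H = ?F - smult (coeff ?F i) ?E"
  have "degree H \<le> i"
    unfolding H_def using F E by (intro degree_diff_le) (auto intro: order_trans[OF degree_smult_le])
  moreover have "coeff H i = 0" by (simp add: H_def E)
  ultimately have "degree H < i" using i by (metis le_neq_implies_less leading_coeff_0_iff degree_0)
  moreover have "H = 0" if "degree H < i"
  proof (rule poly_eqI_degree[of "of_nat ` {..<i}"])
    show "poly H x = poly 0 x" if "x \<in> of_nat ` {..<i}" for x
      using that symbol_root[of _ t u] symbol_root[of _ t "extreme_monomial t :: 'k weyl"] by (auto simp: H_def t)
    show "degree H < card ((of_nat :: nat \<Rightarrow> 'k) ` {..<i})" "degree (0 :: 'k poly) < card ((of_nat :: nat \<Rightarrow> 'k) ` {..<i})"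
      using \<open>degree H < i\<close> i by (simp_all add: card_image inj_on_def)
  qed
  ultimately have "?F = smult (coeff ?F i) ?E" by (simp add: H_def)
  then show ?thesis by blast
qed

definition weyl_degrees :: "'k::field_char_0 weyl \<Rightarrow> int set" where
  "weyl_degrees u = {t. weyl_symbol u t \<noteq> 0}"

lemma weyl_degreesD: "weyl_degrees u \<subseteq> T \<Longrightarrow> t \<notin> T \<Longrightarrow> weyl_symbol u t = 0"
  by (auto simp: weyl_degrees_def)

section \<open>Brackets of symbols and their leading coefficients\<close>

lemma degree_translate [simp]: "degree (translate s F) = degree F"
  by (simp add: translate_def degree_pcompose)

text \<open>
The symbol, in degree \<open>s + t\<close>, of the commutator of homogeneous elements with the symbols \<open>F\<close> in
degree \<open>s\<close> and \<open>G\<close> in degree \<open>t\<close>.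
\<close>

definition symbol_bracket ::
    "'k::field_char_0 poly \<Rightarrow> int \<Rightarrow> 'k poly \<Rightarrow> int \<Rightarrow> 'k poly" where
  "symbol_bracket F s G t = translate t F * G - translate s G * F"

lemma symbol_bracket_zero [simp]: "symbol_bracket F s 0 t = 0" "symbol_bracket 0 s G t = 0"
  by (simp_all add: symbol_bracket_def)

text \<open>
Coefficients with integer exponents: along the lines considered below the exponents may become
negative, and no case distinction is then required.
\<close>

definition icoeff :: "'k::field poly \<Rightarrow> int \<Rightarrow> 'k" where
  "icoeff F i = (if i < 0 then 0 else coeff F (nat i))"

definition idegree_le :: "'k::field poly \<Rightarrow> int \<Rightarrow> bool" where
  "idegree_le F i \<longleftrightarrow> (\<forall>j>i. icoeff F j = 0)"

lemma icoeff_zero [simp]: "icoeff 0 i = 0"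
  by (simp add: icoeff_def)

lemma icoeff_one: "icoeff 1 i = (if i = 0 then 1 else 0)"
  by (auto simp: icoeff_def nat_eq_iff)

lemma icoeff_add: "icoeff (F + G) i = icoeff F i + icoeff G i"
  by (simp add: icoeff_def)

lemma icoeff_diff: "icoeff (F - G) i = icoeff F i - icoeff G i"
  by (simp add: icoeff_def)

lemma icoeff_minus: "icoeff (- F) i = - icoeff F i"
  by (simp add: icoeff_def)

lemma icoeff_smult: "icoeff (smult c F) i = c * icoeff F i"
  by (simp add: icoeff_def)

lemma icoeff_pCons: "icoeff (pCons c F) i = (if i = 0 then c else icoeff F (i - 1))"
proof (cases "i \<le> 0")
  case False
  then have "nat i = Suc (nat (i - 1))" by simp
  with False show ?thesis by (simp add: icoeff_def del: Suc_nat_eq_nat_zadd1)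
qed (auto simp: icoeff_def)

lemma icoeff_neg [simp]: "i < 0 \<Longrightarrow> icoeff F i = 0"
  by (simp add: icoeff_def)

lemma icoeff_pCons_zero: "icoeff (pCons 0 F) i = icoeff F (i - 1)"
  by (simp add: icoeff_pCons)

lemma icoeff_degree: "icoeff F (int (degree F)) = lead_coeff F"
  by (simp add: icoeff_def)

lemma idegree_leD: "idegree_le F i \<Longrightarrow> i < j \<Longrightarrow> icoeff F j = 0"
  by (simp add: idegree_le_def)

lemma idegree_le_iff: "idegree_le F i \<longleftrightarrow> F = 0 \<or> int (degree F) \<le> i"
proof
  assume "idegree_le F i"
  then show "F = 0 \<or> int (degree F) \<le> i"
    using idegree_leD[of F i "int (degree F)"] by (force simp: icoeff_degree)
next
  assume "F = 0 \<or> int (degree F) \<le> i"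
  then show "idegree_le F i"
    by (fastforce simp: idegree_le_def icoeff_def intro: coeff_eq_0)
qed

lemma idegree_le_pConsD:
  assumes "idegree_le (pCons c F) i"
  shows "idegree_le F (i - 1)"
  unfolding idegree_le_def
proof (intro allI impI)
  fix j assume "i - 1 < j"
  show "icoeff F j = 0"
  proof (cases "j < 0")
    case False
    then show ?thesis using idegree_leD[OF assms, of "j + 1"] \<open>i - 1 < j\<close>
      by (simp add: icoeff_pCons)
  qed (simp add: icoeff_def)
qed

text \<open>
Taylor expansion: \<open>F(X+s) - F(X) = s F'(X) + ...\<close>.
\<close>

lemma translate_diff_top:
  assumes "idegree_le F i"
  shows "idegree_le (translate s F - F) (i - 1)
    \<and> icoeff (translate s F - F) (i - 1) = of_int (i * s) * icoeff F i"
  using assms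
proof (induction F arbitrary: i)
  case 0
  then show ?case by (simp add: idegree_le_iff)
next
  case (pCons c F)
  let ?D = "translate s F - F"
  have F: "idegree_le F (i - 1)" by (rule idegree_le_pConsD[OF pCons.prems])
  from pCons.IH[OF F] have D: "idegree_le ?D (i - 2)"
      and top: "icoeff ?D (i - 2) = of_int ((i - 1) * s) * icoeff F (i - 1)"
    by simp_all
  have "translate s (pCons c F) - pCons c F = pCons 0 ?D + smult (of_int s) (translate s F)"
    by (simp add: translate_pCons algebra_simps)
  then have expand: "icoeff (translate s (pCons c F) - pCons c F) j
      = icoeff ?D (j - 1) + of_int s * (icoeff ?D j + icoeff F j)" for j
    by (simp add: icoeff_add icoeff_smult icoeff_pCons_zero icoeff_diff)
  have "icoeff ?D (j - 1) = 0 \<and> icoeff ?D j = 0 \<and> icoeff F j = 0" if "i - 1 < j" for j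
    using that idegree_leD[OF D] idegree_leD[OF F] by simp
  then have "idegree_le (translate s (pCons c F) - pCons c F) (i - 1)"
    by (simp add: idegree_le_def expand)
  moreover have "icoeff ?D (i - 1) = 0" by (rule idegree_leD[OF D]) simp
  then have "icoeff (translate s (pCons c F) - pCons c F) (i - 1)
      = of_int (i * s) * icoeff F (i - 1)"
    by (simp add: expand top algebra_simps)
  then have "icoeff (translate s (pCons c F) - pCons c F) (i - 1)
      = of_int (i * s) * icoeff (pCons c F) i"
    by (simp add: icoeff_pCons)
  ultimately show ?case by simp
qed

lemma icoeff_mult_top:
  assumes "idegree_le F i" "idegree_le G j"
  shows "idegree_le (F * G) (i + j) \<and> icoeff (F * G) (i + j) = icoeff F i * icoeff G j"
  using assms(1)
proof (induction F arbitrary: i)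
  case 0
  then show ?case by (simp add: idegree_le_iff)
next
  case (pCons c F)
  have F: "idegree_le F (i - 1)" by (rule idegree_le_pConsD[OF pCons.prems])
  from pCons.IH[OF F] have le: "idegree_le (F * G) (i + j - 1)"
      and top: "icoeff (F * G) (i + j - 1) = icoeff F (i - 1) * icoeff G j"
    by (simp_all add: algebra_simps)
  have expand: "icoeff (pCons c F * G) m = c * icoeff G m + icoeff (F * G) (m - 1)" for m
    by (simp add: icoeff_add icoeff_smult icoeff_pCons_zero)
  have c: "c = 0" if "i < 0"
    using idegree_leD[OF pCons.prems, of 0] that by (simp add: icoeff_pCons)
  have cG: "c * icoeff G m = 0" if "i + j < m" for m
    using c idegree_leD[OF assms(2), of m] that by (cases "i < 0") auto
  have "idegree_le (pCons c F * G) (i + j)"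
    unfolding idegree_le_def expand using cG idegree_leD[OF le] by simp
  moreover have "icoeff (pCons c F * G) (i + j) = icoeff (pCons c F) i * icoeff G j"
  proof (cases "i = 0")
    case True
    then have "icoeff (F * G) (i + j - 1) = 0" using top by simp
    then show ?thesis using True unfolding expand by (simp add: icoeff_pCons)
  next
    case False
    have "c * icoeff G (i + j) = 0"
      using c False idegree_leD[OF assms(2), of "i + j"] by (cases "i < 0") auto
    then show ?thesis using False unfolding expand by (simp add: icoeff_pCons top)
  qed
  ultimately show ?case by simp
qed

text \<open>
The top coefficients of \<open>F(X+t) G\<close> and \<open>G(X+s) F\<close> cancel, and the linear terms of the Taylor
expansions remain. This is the Poisson bracket of \<open>y^s X^i\<close> and \<open>y^t X^j\<close> for \<open>{X, y} = y\<close>.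
\<close>

lemma symbol_bracket_top:
  assumes F: "idegree_le F i" and G: "idegree_le G j"
  shows "idegree_le (symbol_bracket F s G t) (i + j - 1)
    \<and> icoeff (symbol_bracket F s G t) (i + j - 1) = icoeff F i * icoeff G j * of_int (i * t - j * s)"
proof -
  let ?A = "(translate t F - F) * G" and ?B = "(translate s G - G) * F"
  have eq: "symbol_bracket F s G t = ?A - ?B"
    by (simp add: symbol_bracket_def algebra_simps)
  have A: "idegree_le ?A (i - 1 + j)"
      "icoeff ?A (i - 1 + j) = of_int (i * t) * icoeff F i * icoeff G j"
    using icoeff_mult_top[of "translate t F - F" "i - 1" G j] translate_diff_top[OF F] G by auto
  have B: "idegree_le ?B (j - 1 + i)"
      "icoeff ?B (j - 1 + i) = of_int (j * s) * icoeff G j * icoeff F i"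
    using icoeff_mult_top[of "translate s G - G" "j - 1" F i] translate_diff_top[OF G] F by auto
  have e: "i - 1 + j = i + j - 1" "j - 1 + i = i + j - 1" by simp_all
  show ?thesis
    using A B unfolding e eq by (auto simp: idegree_le_def icoeff_diff algebra_simps)
qed

lemma symbol_bracket_eq_0_degree:
  assumes "symbol_bracket F s G t = 0" "F \<noteq> 0" "G \<noteq> 0"
  shows "int (degree F) * t = int (degree G) * s"
proof -
  have "lead_coeff F * lead_coeff G * of_int (int (degree F) * t - int (degree G) * s) = 0"
    using symbol_bracket_top[of F "int (degree F)" G "int (degree G)" s t] assms(1)
    by (simp add: idegree_le_iff icoeff_degree)
  then have "int (degree F) * t - int (degree G) * s = 0"
    using assms(2,3) by (simp only: mult_eq_0_iff of_int_eq_0_iff leading_coeff_0_iff) simp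
  then show ?thesis by simp
qed

text \<open>
The coefficient at \<open>deg F + deg G - 1\<close> is a nonzero multiple of \<open>(deg F + deg G) s\<close>, whereas the
only nonzero coefficient of \<open>1\<close> is the constant one.
\<close>

lemma symbol_bracket_eq_1_degree:
  assumes "symbol_bracket F s G (- s) = 1"
  shows "degree F + degree G = 1" "s \<noteq> 0"
proof -
  let ?k = "int (degree F)" and ?l = "int (degree G)"
  have nz: "F \<noteq> 0" "G \<noteq> 0" using assms by auto
  show s: "s \<noteq> 0"
  proof
    assume "s = 0"
    then have "symbol_bracket F s G (- s) = 0"
      by (simp add: symbol_bracket_def translate_def)
    then show False using assms by simp
  qed
  have le: "idegree_le (1 :: 'a poly) (?k + ?l - 1)"
    and top: "icoeff (1 :: 'a poly) (?k + ?l - 1)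
      = lead_coeff F * lead_coeff G * of_int (- (?k + ?l) * s)"
    using symbol_bracket_top[of F ?k G ?l s "- s"]
    by (simp_all add: assms idegree_le_iff icoeff_degree algebra_simps)
  have pos: "?k + ?l \<ge> 1" using le by (simp add: idegree_le_iff)
  then have "- (?k + ?l) * s \<noteq> 0" using s by auto
  then have "icoeff (1 :: 'a poly) (?k + ?l - 1) \<noteq> 0"
    unfolding top using nz by (simp only: mult_eq_0_iff of_int_eq_0_iff leading_coeff_0_iff) simp
  then show "degree F + degree G = 1" by (simp add: icoeff_one split: if_splits)
qed

text \<open>
The degree of an element that commutes with \<open>F\<close> is prescribed by \<open>t\<close>; subtracting the multiple of
\<open>U\<close> with the same leading coefficient would lower it.
\<close>

lemma symbol_bracket_eq_0_unique:
  assumes "symbol_bracket F s U t = 0" "symbol_bracket F s V t = 0" "F \<noteq> 0" "U \<noteq> 0" "s \<noteq> 0"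
  shows "\<exists>c. V = smult c U"
proof (cases "V = 0")
  case True
  then show ?thesis by (intro exI[of _ 0]) simp
next
  case False
  define c where "c = lead_coeff V / lead_coeff U"
  define W where "W = V - smult c U"
  have deg: "degree X = degree U" if "X \<noteq> 0" "symbol_bracket F s X t = 0" for X
  proof -
    have "int (degree X) * s = int (degree U) * s"
      by (rule trans[OF sym[OF symbol_bracket_eq_0_degree[OF that(2) assms(3) that(1)]]
            symbol_bracket_eq_0_degree[OF assms(1,3,4)]])
    then have "int (degree X) = int (degree U)"
      using mult_right_cancel[OF assms(5), THEN iffD1] by blast
    then show ?thesis by simp
  qed
  have "symbol_bracket F s W t = symbol_bracket F s V t - smult c (symbol_bracket F s U t)"
    by (simp add: W_def symbol_bracket_def translate_diff translate_smult algebra_simps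
        smult_diff_right)
  then have W: "symbol_bracket F s W t = 0" using assms by simp
  have "coeff W (degree U) = 0"
    using deg[OF False assms(2)] assms(4) by (simp add: W_def c_def)
  then have "W = 0" using deg[OF _ W] by (metis leading_coeff_0_iff)
  then show ?thesis by (auto simp: W_def)
qed

section \<open>Ladders of symbols\<close>

text \<open>
\<open>F\<close> and \<open>G\<close> stand for the symbols of \<open>z\<close> in the degrees \<open>a\<close> and \<open>b\<close>, and \<open>L j\<close> for the symbol of \<open>w\<close>
in the degree \<open>(b-a) j - a\<close>. The assumption \<open>rung\<close> is the part of degree \<open>(b-a) j\<close> of \<open>[z,w] = 1\<close>.
The parameter \<open>e\<close> makes the size bounds invariant under reflection: it is \<open>1\<close> for symbols of elements
of the Weyl algebra, and reflection changes its sign.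
\<close>

locale symbol_ladder =
  fixes e a b :: int and F G :: "'k::field_char_0 poly" and L :: "int \<Rightarrow> 'k poly"
  assumes less: "a < b" and F_nz: "F \<noteq> 0" and G_nz: "G \<noteq> 0"
    and finite_rungs: "finite {j. L j \<noteq> 0}"
    and rung: "symbol_bracket F a (L j) ((b - a) * j - a)
        + symbol_bracket G b (L (j - 1)) ((b - a) * (j - 1) - a) = (if j = 0 then 1 else 0)"
    and F_size: "\<bar>a\<bar> \<le> 2 * int (degree F) + e * a"
    and G_size: "\<bar>b\<bar> \<le> 2 * int (degree G) + e * b"
    and L_size: "L j \<noteq> 0 \<Longrightarrow>
      \<bar>(b - a) * j - a\<bar> \<le> 2 * int (degree (L j)) + e * ((b - a) * j - a)"
begin

abbreviation "n j \<equiv> (b - a) * j - a"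
abbreviation "k \<equiv> int (degree F)"
abbreviation "l \<equiv> int (degree G)"

lemma lowest_rung_exists:
  "\<exists>j0\<le>0. L j0 \<noteq> 0 \<and> (\<forall>j<j0. L j = 0)"
proof -
  let ?S = "{j. L j \<noteq> 0}"
  have "\<exists>j\<le>0. L j \<noteq> 0"
  proof (rule ccontr)
    assume none: "\<not> (\<exists>j\<le>0. L j \<noteq> 0)"
    then have "L 0 = 0" "L (0 - 1) = 0" by auto
    with rung[of 0] show False by simp
  qed
  then obtain j where j: "j \<le> 0" "L j \<noteq> 0" by blast
  show ?thesis
  proof (intro exI[of _ "Min ?S"] conjI allI impI)
    show "Min ?S \<le> 0" using Min_le[OF finite_rungs, of j] j by auto
    show "L (Min ?S) \<noteq> 0" using Min_in[OF finite_rungs] j by auto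
    show "L i = 0" if "i < Min ?S" for i
      using Min_le[OF finite_rungs, of i] that by auto
  qed
qed

lemma lowest_rung_commutes:
  assumes "\<And>j. j < j0 \<Longrightarrow> L j = 0" "j0 < 0"
  shows "symbol_bracket F a (L j0) (n j0) = 0"
  using rung[of j0] assms by simp

lemma bottom_pair:
  assumes "\<And>j. j < 0 \<Longrightarrow> L j = 0"
  shows "symbol_bracket F a (L 0) (- a) = 1" "L 0 \<noteq> 0" "k + int (degree (L 0)) = 1" "a \<noteq> 0"
proof -
  show eq: "symbol_bracket F a (L 0) (- a) = 1"
    using rung[of 0] assms[of "-1"] by simp
  then show "L 0 \<noteq> 0" by auto
  show "k + int (degree (L 0)) = 1" "a \<noteq> 0"
    using symbol_bracket_eq_1_degree[OF eq] by simp_all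
qed

text \<open>
Below the rung \<open>L 0\<close>, which pairs with \<open>F\<close> to \<open>1\<close>, there is nothing, so each equation expresses the
bracket of \<open>F\<close> with the next rung by the current one. The factor of the leading coefficient in the
bracket of \<open>G\<close> with \<open>L i\<close> is \<open>Y + V i\<close>, where \<open>V\<close> and \<open>Y\<close> are the numbers multiplied by
\<open>s\<close> in the last two assumptions. The sign conditions keep it away from \<open>0\<close>, and they also exclude
that the next rung has a larger degree than the equation suggests. Hence no rung vanishes.
\<close>

lemma endless_recursion:
  assumes below: "\<And>j. j < 0 \<Longrightarrow> L j = 0"
    and a: "s * a < 0" and v: "0 \<le> s * (k * b - l * a)"
    and y: "0 < s * (- l * a - (1 - k) * b)"
  shows False
proof -
  define V where "V = k * b - l * a"
  define Y where "Y = - l * a - (1 - k) * b"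
  have rungs: "L (int i) \<noteq> 0 \<and> int (degree (L (int i))) = 1 - k + (l - k) * int i" for i
  proof (induction i)
    case 0
    then show ?case using bottom_pair[OF below] by simp
  next
    case (Suc i)
    let ?i = "int i"
    define J where "J = int (degree (L ?i))"
    define J' where "J' = int (degree (L (?i + 1)))"
    have J: "J = 1 - k + (l - k) * ?i" using Suc by (simp add: J_def)
    let ?B = "symbol_bracket G b (L ?i) (n ?i)" and ?A = "symbol_bracket F a (L (?i + 1)) (n (?i + 1))"
    \<comment> \<open>The equation between this rung and the next one; its right-hand side is \<open>0\<close> as \<open>?i + 1 \<noteq> 0\<close>.\<close>
    have AB: "?A = - ?B"
      using rung[of "?i + 1"] by (simp add: eq_neg_iff_add_eq_0)
    have lJ: "l * n ?i - J * b = Y + V * ?i"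
      by (simp add: J Y_def V_def algebra_simps)
    have "0 < s * Y + s * V * ?i"
      using y v by (simp add: Y_def V_def add_pos_nonneg)
    then have ne: "Y + V * ?i \<noteq> 0" by (metis distrib_left mult.assoc mult_zero_right less_irrefl)
    have B: "idegree_le ?B (l + J - 1)"
        "icoeff ?B (l + J - 1) = lead_coeff G * lead_coeff (L ?i) * of_int (Y + V * ?i)"
      using symbol_bracket_top[of G l "L ?i" J b "n ?i"]
      by (simp_all only: lJ) (simp_all add: J_def idegree_le_iff icoeff_degree)
    have B_nz: "icoeff ?B (l + J - 1) \<noteq> 0"
      unfolding B(2) using ne G_nz Suc
      by (simp only: mult_eq_0_iff of_int_eq_0_iff leading_coeff_0_iff) simp
    then have L_nz: "L (?i + 1) \<noteq> 0"
      using AB by auto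
    have A: "idegree_le ?A (k + J' - 1)"
        "icoeff ?A (k + J' - 1)
          = lead_coeff F * lead_coeff (L (?i + 1)) * of_int (k * n (?i + 1) - J' * a)"
      using symbol_bracket_top[of F k "L (?i + 1)" J' a "n (?i + 1)"]
      by (simp_all add: J'_def idegree_le_iff icoeff_degree)
    have A_nz: "icoeff ?A (l + J - 1) \<noteq> 0"
      unfolding AB icoeff_minus using B_nz by simp
    have ge: "l + J - 1 \<le> k + J' - 1"
      using idegree_leD[OF A(1)] A_nz by (metis not_less)
    have "\<not> l + J - 1 < k + J' - 1"
    proof
      assume lt: "l + J - 1 < k + J' - 1"
      have "icoeff ?A (k + J' - 1) = 0"
        unfolding AB icoeff_minus using idegree_leD[OF B(1) lt] by simp
      then have X: "k * n (?i + 1) - J' * a = 0"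
        unfolding A(2) using F_nz L_nz
        by (simp only: mult_eq_0_iff of_int_eq_0_iff leading_coeff_0_iff) simp
      \<comment> \<open>The excess of the degree over the expected one; all terms below get the same sign.\<close>
      define d where "d = J' - (1 - k + (l - k) * (?i + 1))"
      have d: "d \<ge> 1" using lt by (simp add: d_def J algebra_simps)
      have J': "J' = 1 - k + (l - k) * (?i + 1) + d" by (simp add: d_def)
      have "k * n (?i + 1) - J' * a = - a + V * (?i + 1) - d * a"
        unfolding J' V_def by (simp add: algebra_simps)
      then have "s * (- a + V * (?i + 1) - d * a) = 0" using X by simp
      then have "(- (s * a)) * (1 + d) + s * V * (?i + 1) = 0"
        by (simp add: algebra_simps)
      moreover have "0 < (- (s * a)) * (1 + d)" using a d by (intro mult_pos_pos) auto
      moreover have "0 \<le> s * V * (?i + 1)" using v by (simp add: V_def)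
      ultimately show False by linarith
    qed
    with ge have "J' = l - k + J" by simp
    then show ?case using L_nz by (simp add: J'_def J algebra_simps)
  qed
  then have "range int \<subseteq> {j. L j \<noteq> 0}" by auto
  then have "finite (range int)" using finite_rungs finite_subset by blast
  then show False using finite_imageD[of int UNIV] by simp
qed

text \<open>
If the lowest rung has negative index, its degree is negative and it commutes with \<open>F\<close>. The sizes
\<open>2 deg + e t\<close> of commuting elements are proportional to their degrees \<open>t\<close> and never negative, which
excludes \<open>a > 0\<close> and makes \<open>F\<close> constant for \<open>a = 0\<close>.
Otherwise it pairs with \<open>F\<close> to \<open>1\<close>, the size bounds leave only \<open>a = 1\<close>, and the recursion does not end.
\<close>

lemma no_nonnegative_degrees:
  assumes a: "0 \<le> a" and nonconst: "a = 0 \<Longrightarrow> degree F \<noteq> 0"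
  shows False
proof -
  obtain j0 where j0: "L j0 \<noteq> 0" "\<And>j. j < j0 \<Longrightarrow> L j = 0" "j0 \<le> 0"
    using lowest_rung_exists by blast
  define K where "K = 2 * k + e * a"
  have K: "a \<le> K" using F_size a by (simp add: K_def)
  show False
  proof (cases "j0 = 0")
    case False
    define J where "J = int (degree (L j0))"
    define M where "M = 2 * J + e * n j0"
    have M: "\<bar>n j0\<bar> \<le> M" using L_size[OF j0(1)] by (simp add: M_def J_def)
    have "(b - a) * j0 < 0" using False j0(3) less by (simp add: mult_pos_neg)
    then have n: "n j0 < 0" using a by simp
    have comm: "k * n j0 = J * a"
      using symbol_bracket_eq_0_degree[OF lowest_rung_commutes F_nz j0(1)] j0 False
      by (simp add: J_def)
    have "K * n j0 = M * a" using comm by (simp add: K_def M_def algebra_simps)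
    moreover have "0 \<le> M * a" using M a by simp
    ultimately have "K \<le> 0" using n by (metis mult_pos_neg not_less)
    then have "a = 0" using K a by simp
    then have "k * n j0 = 0" using comm by simp
    then have "k = 0" using n by (simp only: mult_eq_0_iff) auto
    then show False using nonconst \<open>a = 0\<close> by simp
  next
    case True
    then have below: "\<And>j. j < 0 \<Longrightarrow> L j = 0" using j0(2) by simp
    note pair = bottom_pair[OF below]
    have L0: "a \<le> 2 * int (degree (L 0)) - e * a" using L_size[OF pair(2)] a by simp
    then have a1: "a = 1" using K pair(3,4) a unfolding K_def by linarith
    have e: "2 * k + e = 1" using K L0 pair(3) unfolding K_def a1 by simp
    have Gb: "b \<le> 2 * l + e * b" using G_size by simp
    have eb: "e * b = b - 2 * (k * b)"
    proof -
      have "e * b = (1 - 2 * k) * b" using e by simp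
      then show ?thesis by (simp add: algebra_simps)
    qed
    show False
    proof (rule endless_recursion[of "- 1"])
      show "\<And>j. j < 0 \<Longrightarrow> L j = 0" by (rule below)
      show "- 1 * a < 0" by (simp add: a1)
      show "0 \<le> - 1 * (k * b - l * a)" using Gb eb by (simp add: a1)
      show "0 < - 1 * (- l * a - (1 - k) * b)"
        using Gb eb less by (simp add: a1 algebra_simps)
    qed
  qed
qed

text \<open>
The sizes of \<open>F\<close> and \<open>L 0\<close> add up to \<open>2\<close> and are at least \<open>-a\<close>, which determines \<open>a\<close> and the size of
\<open>F\<close>. If \<open>G\<close> were larger than necessary, the recursion would not end.
\<close>

lemma minimal_if_bottom_pair:
  assumes ab: "a < 0" "0 < b" and below: "\<And>j. j < 0 \<Longrightarrow> L j = 0"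
  shows "a = - 1" "2 * k + e * a = - a" "2 * l + e * b = b"
proof -
  note pair = bottom_pair[OF below]
  have L0: "- a \<le> 2 * int (degree (L 0)) - e * a" using L_size[OF pair(2)] ab by simp
  have K: "- a \<le> 2 * k + e * a" using F_size ab by simp
  show a1: "a = - 1" using K L0 pair(3) ab by linarith
  show K1: "2 * k + e * a = - a" using K L0 pair(3) a1 by simp
  have Gb: "b \<le> 2 * l + e * b" using G_size ab by simp
  have eb: "e * b = 2 * (k * b) - b"
  proof -
    have "e * b = (2 * k - 1) * b" using K1 a1 by simp
    then show ?thesis by (simp add: algebra_simps)
  qed
  show "2 * l + e * b = b"
  proof (rule ccontr)
    assume "2 * l + e * b \<noteq> b"
    with Gb have Gb: "b < 2 * l + e * b" by simp
    show False
    proof (rule endless_recursion[of 1])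
      show "\<And>j. j < 0 \<Longrightarrow> L j = 0" by (rule below)
      show "1 * a < 0" by (simp add: a1)
      show "0 \<le> 1 * (k * b - l * a)" using ab by (simp add: a1)
      show "0 < 1 * (- l * a - (1 - k) * b)"
        using Gb eb by (simp add: a1 algebra_simps)
    qed
  qed
qed

text \<open>
The exponents \<open>J j\<close> lie on the lowest line of slope \<open>l - k\<close> above all pairs \<open>(j, deg (L j))\<close>; with this
slope both brackets in each rung equation have the same top exponent. Its coefficient is governed
by the factors \<open>X j\<close> and \<open>Y j\<close>, which grow by the positive amount \<open>V\<close> from one rung to the next and
satisfy \<open>0 \<le> X j0\<close> and \<open>Y j1 \<le> 0\<close> because the extreme rungs commute with \<open>F\<close> and \<open>G\<close>.

If the right-hand side \<open>1\<close> meets the line, then \<open>X 0 = -a\<close>, so \<open>V \<le> -a\<close>, and the size bounds for \<open>F\<close>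
and \<open>G\<close> become equalities. If not, the equations at the two ends of the set of rungs on the line
make \<open>X\<close> vanish at the first and \<open>Y\<close> at the last of them. The sign conditions force these to
be \<open>j0\<close> and \<open>j1\<close>, and \<open>X j0 = 0 = Y j1\<close> are two linear equations for \<open>n j0\<close> and \<open>J j0\<close>.
\<close>

lemma leading_form:
  assumes ab: "a < 0" "0 < b"
    and lo: "L j0 \<noteq> 0" "\<And>j. j < j0 \<Longrightarrow> L j = 0" "j0 < 0"
    and hi: "L j1 \<noteq> 0" "\<And>j. j1 < j \<Longrightarrow> L j = 0" "0 \<le> j1"
  shows "(b = 1 \<and> 2 * k + e * a = - a \<and> 2 * l + e * b = b) \<or> n j0 = (j1 - j0) * a"
proof -
  let ?S = "{j. L j \<noteq> 0}"
  define w where "w j = int (degree (L j)) - (l - k) * j" for j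
  define C where "C = Max (w ` ?S)"
  define J where "J j = C + (l - k) * j" for j
  define c where "c j = icoeff (L j) (J j)" for j
  define V where "V = k * b - l * a"
  have deg_le: "int (degree (L j)) \<le> J j" if "L j \<noteq> 0" for j
  proof -
    have "w j \<le> C" unfolding C_def using finite_rungs that by simp
    then show ?thesis by (simp add: w_def J_def)
  qed
  then have le: "idegree_le (L j) (J j)" for j by (auto simp: idegree_le_iff)
  have "C \<in> w ` ?S" unfolding C_def using finite_rungs lo(1) by (intro Max_in) auto
  then obtain jm where jm: "L jm \<noteq> 0" "C = w jm" by auto
  then have "J jm = int (degree (L jm))" by (simp add: w_def J_def)
  then have c_jm: "c jm \<noteq> 0" using jm by (simp add: c_def icoeff_degree)
  have c_L: "L j \<noteq> 0" if "c j \<noteq> 0" for j using that by (auto simp: c_def)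
  define X where "X j = k * n j - J j * a" for j
  define Y where "Y j = l * n j - J j * b" for j
  have X_step: "X i = X j + V * (i - j)" for i j
    by (simp add: X_def J_def V_def algebra_simps)
  have Y_step: "Y i = Y j + V * (i - j)" for i j
    by (simp add: Y_def J_def V_def algebra_simps)
  have eq: "lead_coeff F * c j * of_int (X j) + lead_coeff G * c (j - 1) * of_int (Y (j - 1))
      = icoeff (if j = 0 then 1 else 0) (k + J j - 1)" for j
  proof -
    have same: "k + J j - 1 = l + J (j - 1) - 1" by (simp add: J_def algebra_simps)
    have "icoeff (symbol_bracket F a (L j) (n j)) (k + J j - 1)
        = lead_coeff F * c j * of_int (X j)"
      using symbol_bracket_top[of F k "L j" "J j" a "n j"] le
      by (simp add: idegree_le_iff icoeff_degree c_def X_def)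
    moreover have "icoeff (symbol_bracket G b (L (j - 1)) (n (j - 1))) (k + J j - 1)
        = lead_coeff G * c (j - 1) * of_int (Y (j - 1))"
      unfolding same using symbol_bracket_top[of G l "L (j - 1)" "J (j - 1)" b "n (j - 1)"] le
      by (simp add: idegree_le_iff icoeff_degree c_def Y_def)
    ultimately show ?thesis by (simp add: icoeff_add flip: rung)
  qed
  \<comment> \<open>In terms of the sizes, \<open>2 V\<close> is a sum of two products of positive numbers.\<close>
  have V2: "2 * V = (2 * k + e * a) * b + (2 * l + e * b) * (- a)"
    by (simp add: V_def algebra_simps)
  have Fs: "- a \<le> 2 * k + e * a" and Gs: "b \<le> 2 * l + e * b"
    using F_size G_size ab by auto
  have V_ge: "2 * V \<ge> 2 * (- a * b)"
    using mult_right_mono[OF Fs, of b] mult_right_mono[OF Gs, of "- a"] ab unfolding V2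
    by (simp add: algebra_simps)
  have "0 < - a * b" using ab by (intro mult_pos_pos) auto
  then have V_pos: "0 < V" using V_ge by linarith
  have X_lo: "0 \<le> X j0"
  proof -
    have "k * n j0 = int (degree (L j0)) * a"
      by (rule symbol_bracket_eq_0_degree[OF lowest_rung_commutes[OF lo(2,3)] F_nz lo(1)])
    then have "X j0 = (J j0 - int (degree (L j0))) * (- a)"
      by (simp add: X_def algebra_simps)
    then show ?thesis using deg_le[OF lo(1)] ab by (simp add: mult_nonneg_nonpos)
  qed
  have Y_hi: "Y j1 \<le> 0"
  proof -
    have "symbol_bracket G b (L j1) (n j1) = 0"
      using rung[of "j1 + 1"] hi by simp
    then have "l * n j1 = int (degree (L j1)) * b"
      by (rule symbol_bracket_eq_0_degree[OF _ G_nz hi(1)])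
    then have "Y j1 = - ((J j1 - int (degree (L j1))) * b)"
      by (simp add: Y_def algebra_simps)
    then show ?thesis using deg_le[OF hi(1)] ab by simp
  qed
  show ?thesis
  proof (cases "k + J 0 - 1 = 0")
    case True
    then have J0: "J 0 = 1 - k" by simp
    have "X 0 = - a" unfolding X_def J0 by (simp add: algebra_simps)
    moreover have "V * (- j0) \<ge> V * 1" using V_pos lo(3) by (intro mult_left_mono) auto
    ultimately have Va: "V \<le> - a" using X_step[of 0 j0] X_lo by simp
    then have "- a * b \<le> - a * 1" using V_ge by linarith
    then have b1: "b = 1" using ab by (simp add: mult_le_cancel_left)
    have Ga: "- a \<le> (2 * l + e * b) * (- a)"
      using mult_right_mono[OF Gs, of "- a"] ab b1 by simp
    have "2 * k + e * a + (2 * l + e * b) * (- a) \<le> 2 * (- a)"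
      using V2 Va b1 by simp
    then have "2 * k + e * a = - a" "(2 * l + e * b) * (- a) = - a"
      using Ga Fs by linarith+
    then show ?thesis using b1 ab by simp
  next
    case False
    \<comment> \<open>Even for \<open>j = 0\<close>, since the right-hand side \<open>1\<close> has no coefficient on the line.\<close>
    have eq0: "lead_coeff F * c j * of_int (X j) + lead_coeff G * c (j - 1) * of_int (Y (j - 1)) = 0"
      for j
      unfolding eq using False by (auto simp: icoeff_one)
    let ?T = "{j. c j \<noteq> 0}"
    have fin: "finite ?T" using finite_rungs c_L by (auto intro: finite_subset[rotated])
    define i0 where "i0 = Min ?T"
    define i1 where "i1 = Max ?T"
    have "?T \<noteq> {}" using c_jm by auto
    then have "i0 \<in> ?T" "i1 \<in> ?T" unfolding i0_def i1_def using Min_in[OF fin] Max_in[OF fin] by blast+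
    then have i: "c i0 \<noteq> 0" "c i1 \<noteq> 0" by auto
    have "c (i0 - 1) = 0" using Min_le[OF fin, of "i0 - 1"] by (auto simp: i0_def)
    then have X0: "X i0 = 0" using eq0[of i0] i F_nz by simp
    have "c (i1 + 1) = 0" using Max_ge[OF fin, of "i1 + 1"] by (auto simp: i1_def)
    then have Y0: "Y i1 = 0" using eq0[of "i1 + 1"] i G_nz by simp
    have "j0 \<le> i0" using lo(2)[of i0] c_L[OF i(1)] by force
    then have "V * (j0 - i0) \<le> 0" using V_pos by (simp add: mult_nonneg_nonpos)
    then have Xj0: "X j0 = 0" using X_step[of j0 i0] X0 X_lo by simp
    have "i1 \<le> j1" using hi(2)[of i1] c_L[OF i(2)] by force
    then have "0 \<le> V * (j1 - i1)" using V_pos by simp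
    then have Yj1: "Y j1 = 0" using Y_step[of j1 i1] Y0 Y_hi by simp
    have Yj0: "Y j0 = V * (j0 - j1)" using Y_step[of j0 j1] Yj1 by simp
    have "V * n j0 = b * X j0 - a * Y j0"
      by (simp add: V_def X_def Y_def algebra_simps)
    also have "\<dots> = V * ((j1 - j0) * a)"
      unfolding Xj0 Yj0 by (simp add: algebra_simps)
    finally have "n j0 = (j1 - j0) * a" using V_pos by (simp only: mult_left_cancel)
    then show ?thesis by simp
  qed
qed

end

text \<open>
The substitution \<open>X \<mapsto> -X\<close> for polynomials and \<open>t \<mapsto> -t\<close> for degrees preserves brackets; it does not
come from a map of the Weyl algebra to itself.
\<close>

definition mirror :: "'k::field_char_0 poly \<Rightarrow> 'k poly" where
  "mirror F = pcompose F [:0, - 1:]"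

lemma degree_mirror [simp]: "degree (mirror F) = degree F"
  by (simp add: mirror_def degree_pcompose)

lemma mirror_eq_0_iff [simp]: "mirror F = 0 \<longleftrightarrow> F = 0"
  by (simp add: mirror_def pcompose_eq_0_iff)

lemma mirror_add: "mirror (F + G) = mirror F + mirror G"
  by (simp add: mirror_def pcompose_add)

lemma translate_mirror: "translate (- s) (mirror F) = mirror (translate s F)"
proof -
  have "pcompose [:0, - 1:] [:of_int (- s), 1 :: 'a:] = pcompose [:of_int s, 1:] [:0, - 1:]"
    by (simp add: pcompose_pCons)
  then show ?thesis
    by (simp only: mirror_def translate_def flip: pcompose_assoc)
qed

lemma symbol_bracket_mirror:
  "symbol_bracket (mirror F) (- s) (mirror G) (- t) = mirror (symbol_bracket F s G t)"
  unfolding symbol_bracket_def translate_mirror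
  by (simp add: mirror_def pcompose_diff pcompose_mult)

context symbol_ladder
begin

text \<open>
Reflection exchanges the roles of \<open>F\<close> and \<open>G\<close> and the two ends of the ladder; the lowest
rung of the reflected ladder is the highest rung of the given one.
\<close>

lemma mirror_ladder:
  "symbol_ladder (- e) (- b) (- a) (mirror G) (mirror F) (\<lambda>j. mirror (L (- 1 - j)))"
proof
  have deg: "(- a - - b) * j - - b = - ((b - a) * (- 1 - j) - a)" for j
    by (simp add: algebra_simps)
  show "- b < - a" using less by simp
  show "mirror G \<noteq> 0" "mirror F \<noteq> 0" using F_nz G_nz by simp_all
  have "{j. mirror (L (- 1 - j)) \<noteq> 0} \<subseteq> (\<lambda>j. - 1 - j) ` {j. L j \<noteq> 0}"
    by (force simp: image_iff)
  then show "finite {j. mirror (L (- 1 - j)) \<noteq> 0}"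
    using finite_rungs finite_subset by blast
  show "\<bar>- b\<bar> \<le> 2 * int (degree (mirror G)) + - e * - b"
    "\<bar>- a\<bar> \<le> 2 * int (degree (mirror F)) + - e * - a"
    using F_size G_size by simp_all
  show "\<bar>(- a - - b) * j - - b\<bar> \<le> 2 * int (degree (mirror (L (- 1 - j)))) + - e * ((- a - - b) * j - - b)"
    if "mirror (L (- 1 - j)) \<noteq> 0" for j
  proof -
    have "L (- 1 - j) \<noteq> 0" using that by simp
    from L_size[OF this] show ?thesis
      unfolding deg by (simp only: degree_mirror abs_minus_cancel minus_mult_minus)
  qed
  show "symbol_bracket (mirror G) (- b) (mirror (L (- 1 - j))) ((- a - - b) * j - - b)
      + symbol_bracket (mirror F) (- a) (mirror (L (- 1 - (j - 1)))) ((- a - - b) * (j - 1) - - b)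
      = (if j = 0 then 1 else 0)" for j
  proof -
    let ?A = "symbol_bracket F a (L (- j)) (n (- j))"
    let ?B = "symbol_bracket G b (L (- j - 1)) (n (- j - 1))"
    have shift: "- 1 - (j - 1) = - j" "- 1 - j = - j - 1" by simp_all
    have "mirror ?B + mirror ?A = mirror (?A + ?B)"
      by (simp add: mirror_add add.commute)
    also have "?A + ?B = (if j = 0 then 1 else 0)"
      unfolding rung[of "- j"] by simp
    also have "mirror \<dots> = (if j = 0 then 1 else 0)"
      by (simp add: mirror_def pcompose_1)
    finally show ?thesis
      unfolding deg symbol_bracket_mirror shift .
  qed
qed

lemma no_nonpositive_degrees:
  assumes "b \<le> 0" "b = 0 \<Longrightarrow> degree G \<noteq> 0"
  shows False
proof -
  interpret m: symbol_ladder "- e" "- b" "- a" "mirror G" "mirror F" "\<lambda>j. mirror (L (- 1 - j))"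
    by (rule mirror_ladder)
  show False using m.no_nonnegative_degrees assms by simp
qed

text \<open>
The case distinction is whether the lowest rung pairs with \<open>F\<close> to \<open>1\<close>, the highest one with \<open>G\<close> to \<open>1\<close>,
or neither.
\<close>

lemma straddling_ladder:
  assumes ab: "a < 0" "0 < b"
  shows "((a = - 1 \<or> b = 1) \<and> 2 * k + e * a = - a \<and> 2 * l + e * b = b)
    \<or> (\<exists>j0 N. j0 < 0 \<and> L j0 \<noteq> 0 \<and> L (j0 + int N) \<noteq> 0
        \<and> (\<forall>j. L j \<noteq> 0 \<longrightarrow> j0 \<le> j \<and> j \<le> j0 + int N)
        \<and> n j0 = int N * a)"
proof -
  interpret m: symbol_ladder "- e" "- b" "- a" "mirror G" "mirror F" "\<lambda>j. mirror (L (- 1 - j))"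
    by (rule mirror_ladder)
  obtain j0 where lo: "L j0 \<noteq> 0" "\<And>j. j < j0 \<Longrightarrow> L j = 0" "j0 \<le> 0"
    using lowest_rung_exists by blast
  obtain i1 where i1: "mirror (L (- 1 - i1)) \<noteq> 0" "\<And>j. j < i1 \<Longrightarrow> mirror (L (- 1 - j)) = 0" "i1 \<le> 0"
    using m.lowest_rung_exists by blast
  define j1 where "j1 = - 1 - i1"
  have hi: "L j1 \<noteq> 0" "\<And>j. j1 < j \<Longrightarrow> L j = 0" "- 1 \<le> j1"
    using i1(1,3) i1(2)[of "- 1 - j" for j] by (auto simp: j1_def)
  consider "j0 = 0" | "j1 = - 1" | "j0 < 0" "0 \<le> j1" using lo hi by linarith
  then show ?thesis
  proof cases
    case 1
    then show ?thesis using minimal_if_bottom_pair[OF ab] lo(2) by blast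
  next
    case 2
    then have "mirror (L (- 1 - j)) = 0" if "j < 0" for j using hi(2)[of "- 1 - j"] that by simp
    then show ?thesis using m.minimal_if_bottom_pair ab by simp
  next
    case 3
    have "j0 \<le> j \<and> j \<le> j1" if "L j \<noteq> 0" for j using lo(2)[of j] hi(2)[of j] that by force
    moreover have "j1 = j0 + int (nat (j1 - j0))" "int (nat (j1 - j0)) = j1 - j0"
      using 3 by simp_all
    ultimately show ?thesis
      using leading_form[OF ab lo(1,2) 3(1) hi(1,2) 3(2)] 3(1) lo(1) hi(1) by metis
  qed
qed

end

section \<open>Partners of a generator\<close>

lemma subalgebra_generated: "subalgebra (generated_subalgebra S)"
  unfolding generated_subalgebra_def
proof (rule hull_in)
  fix T :: "'a weyl set set"
  assume "Ball T subalgebra"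
  then show "subalgebra (\<Inter>T)"
    unfolding subalgebra_def by (auto intro!: weyl.subspace_Inter)
qed

lemma generated_inc: "x \<in> S \<Longrightarrow> x \<in> generated_subalgebra S"
  unfolding generated_subalgebra_def by (rule hull_inc)

lemma generated_minimal: "S \<subseteq> B \<Longrightarrow> subalgebra B \<Longrightarrow> generated_subalgebra S \<subseteq> B"
  unfolding generated_subalgebra_def by (rule hull_minimal)

lemma subalgebraD:
  assumes "subalgebra B"
  shows "0 \<in> B" "1 \<in> B" "x \<in> B \<Longrightarrow> y \<in> B \<Longrightarrow> x + y \<in> B"
    "x \<in> B \<Longrightarrow> y \<in> B \<Longrightarrow> x - y \<in> B" "x \<in> B \<Longrightarrow> weyl_scale c x \<in> B"
    "x \<in> B \<Longrightarrow> y \<in> B \<Longrightarrow> x * y \<in> B"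
  using assms weyl.subspace_0[of B] weyl.subspace_add[of B x y] weyl.subspace_diff[of B x y]
    weyl.subspace_scale[of B x c]
  by (simp_all add: subalgebra_def)

lemma subalgebra_power:
  assumes "subalgebra B" "x \<in> B"
  shows "x ^ i \<in> B"
  by (induction i) (use assms subalgebraD(2,6) in auto)

lemma generated_p_q: "generated_subalgebra {weyl_p, weyl_q} = (UNIV :: 'k::field weyl set)"
proof -
  let ?B = "generated_subalgebra {weyl_p, weyl_q} :: 'k weyl set"
  note B = subalgebraD[OF subalgebra_generated[of "{weyl_p, weyl_q} :: 'k weyl set"]]
  have pq: "weyl_p \<in> ?B" "weyl_q \<in> ?B" by (simp_all add: generated_inc)
  have "u \<in> ?B" for u
    by (induction u rule: weyl_induct) (simp_all add: B pq)
  then show ?thesis by blast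
qed

definition left_combinations :: "'k::field weyl \<Rightarrow> 'k weyl set \<Rightarrow> 'k weyl set" where
  "left_combinations v C = {\<Sum>i<n. v ^ i * f i |n f. \<forall>i. f i \<in> C}"

lemma left_combinations_add:
  assumes C: "subalgebra C" and x: "x \<in> left_combinations v C" and y: "y \<in> left_combinations v C"
  shows "x + y \<in> left_combinations v C"
proof -
  obtain n f where f: "\<forall>i. f i \<in> C" "x = (\<Sum>i<n. v ^ i * f i)"
    using x by (auto simp: left_combinations_def)
  obtain m g where g: "\<forall>i. g i \<in> C" "y = (\<Sum>i<m. v ^ i * g i)"
    using y by (auto simp: left_combinations_def)
  have extend: "(\<Sum>i<n. v ^ i * f i) = (\<Sum>i<max n m. v ^ i * (if i < n then f i else 0))"
    for n m and f :: "nat \<Rightarrow> 'a weyl"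
    by (rule sum.mono_neutral_cong_left) auto
  define h where "h i = (if i < n then f i else 0) + (if i < m then g i else 0)" for i
  have "x + y = (\<Sum>i<max n m. v ^ i * h i)"
    unfolding f(2) g(2) h_def distrib_left sum.distrib
    using extend[of f n m] extend[of g m n] by (simp add: max.commute)
  moreover have "\<forall>i. h i \<in> C"
    using f g subalgebraD(1,3)[OF C] by (auto simp: h_def)
  ultimately show ?thesis unfolding left_combinations_def by blast
qed

lemma left_combinations_monomial:
  assumes C: "subalgebra C" and "f \<in> C"
  shows "v ^ i * f \<in> left_combinations v C"
proof -
  have "v ^ i * f = (\<Sum>j<Suc i. v ^ j * (if j = i then f else 0))" by simp
  then show ?thesis
    unfolding left_combinations_def using assms subalgebraD(1)[OF C]
    by (intro CollectI exI[of _ "Suc i"] exI[of _ "\<lambda>j. if j = i then f else 0"]) auto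
qed

lemma left_combinations_sum:
  assumes "subalgebra C" "finite A" "\<And>i. i \<in> A \<Longrightarrow> x i \<in> left_combinations v C"
  shows "sum x A \<in> left_combinations v C"
  using assms(2,3)
proof (induction A rule: finite_induct)
  case empty
  show ?case using left_combinations_monomial[OF assms(1) subalgebraD(1)[OF assms(1)], of v 0] by simp
next
  case (insert i A)
  then show ?case by (simp add: left_combinations_add[OF assms(1)])
qed

lemma left_combinations_mult_left:
  assumes C: "subalgebra C" and x: "x \<in> left_combinations v C"
    and r: "\<And>i f. f \<in> C \<Longrightarrow> r * (v ^ i * f) \<in> left_combinations v C"
  shows "r * x \<in> left_combinations v C"
proof -
  obtain n f where f: "\<forall>i. f i \<in> C" "x = (\<Sum>i<n. v ^ i * f i)"
    using x by (auto simp: left_combinations_def)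
  show ?thesis unfolding f(2) sum_distrib_left
    by (rule left_combinations_sum[OF C]) (use f r in auto)
qed

lemma generated_singleton_commutes:
  assumes "f \<in> generated_subalgebra {z}"
  shows "z * f = f * z"
proof -
  have "subalgebra {f. z * f = f * z}"
    unfolding subalgebra_def weyl.subspace_def
    by (auto simp: distrib_left distrib_right weyl_scale_mult_left weyl_scale_mult_right)
      (metis mult.assoc)
  then have "generated_subalgebra {z} \<subseteq> {f. z * f = f * z}"
    by (rule generated_minimal[rotated]) simp
  then show ?thesis using assms by auto
qed

lemma commutator_left_combination:
  assumes zv: "commutator z v = 1" and f: "\<And>i. f i \<in> generated_subalgebra {z}"
  shows "commutator z (\<Sum>i<Suc n. v ^ i * f i)
    = (\<Sum>i<n. v ^ i * weyl_scale (of_nat (Suc i)) (f (Suc i)))"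
proof -
  have "z * (v ^ i * f i) - v ^ i * f i * z = weyl_scale (of_nat i) (v ^ (i - 1) * f i)" for i
  proof -
    have "z * (v ^ i * f i) = v ^ i * (z * f i) + weyl_scale (of_nat i) (v ^ (i - 1) * f i)"
      by (simp add: commutator_power[OF zv] distrib_right weyl_scale_mult_left flip: mult.assoc)
    then show ?thesis
      by (simp add: generated_singleton_commutes[OF f] mult.assoc)
  qed
  then have "commutator z (\<Sum>i<Suc n. v ^ i * f i)
      = (\<Sum>i<Suc n. weyl_scale (of_nat i) (v ^ (i - 1) * f i))"
    unfolding commutator_def sum_distrib_left sum_distrib_right
    by (simp only: flip: sum_subtractf)
  then show ?thesis
    by (simp add: sum.lessThan_Suc_shift weyl_scale_mult_right del: sum.lessThan_Suc of_nat_Suc)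
qed

text \<open>
The commutator with \<open>z\<close> acts as the derivation \<open>d/dv\<close>, with the polynomials in \<open>z\<close> as constants. It
lowers the length of the relation, and characteristic \<open>0\<close> makes the new coefficients nonzero
multiples of the old ones.
\<close>

lemma left_combination_eq_0:
  fixes z v :: "'k::field_char_0 weyl"
  assumes zv: "commutator z v = 1" and "\<And>i. f i \<in> generated_subalgebra {z}"
    and "(\<Sum>i<n. v ^ i * f i) = 0" "i < n"
  shows "f i = 0"
  using assms(2-)
proof (induction n arbitrary: f i)
  case 0
  then show ?case by simp
next
  case (Suc n)
  have "(\<Sum>i<n. v ^ i * weyl_scale (of_nat (Suc i)) (f (Suc i))) = 0"
    using commutator_left_combination[OF zv, of f n, OF Suc.prems(1)] unfolding Suc.prems(2)
    by (simp add: commutator_def)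
  then have "weyl_scale (of_nat (Suc i)) (f (Suc i)) = 0" if "i < n" for i
    using Suc.IH[of "\<lambda>i. weyl_scale (of_nat (Suc i)) (f (Suc i))" i] that
      Suc.prems(1) subalgebraD(5)[OF subalgebra_generated] by blast
  then have pos: "f (Suc i) = 0" if "i < n" for i
    using that by (simp add: weyl.scale_eq_0_iff del: of_nat_Suc)
  then have "f 0 = 0"
    using Suc.prems(2) by (simp add: sum.lessThan_Suc_shift del: sum.lessThan_Suc)
  then show ?case using pos Suc.prems(3) by (cases i) auto
qed

text \<open>
The sums of products \<open>v^i f\<close> with polynomials \<open>f\<close> in \<open>z\<close> are stable under left multiplication
by \<open>z\<close> and \<open>v\<close>, so they exhaust the algebra. Written in this form, \<open>w - v\<close> has only the term with \<open>i = 0\<close>, since it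
commutes with \<open>z\<close>.
\<close>

lemma partner_generates:
  fixes z v w :: "'k::field_char_0 weyl"
  assumes zv: "commutator z v = 1" and gen: "generated_subalgebra {z, v} = UNIV"
    and zw: "commutator z w = 1"
  shows "generated_subalgebra {z, w} = UNIV"
proof -
  let ?C = "generated_subalgebra {z}" and ?T = "left_combinations v (generated_subalgebra {z})"
  note C = subalgebra_generated[of "{z}"]
  have z_T: "z * x \<in> ?T" if "x \<in> ?T" for x
  proof (rule left_combinations_mult_left[OF C that])
    fix i f assume f: "f \<in> ?C"
    have "z * (v ^ i * f) = v ^ i * (z * f) + v ^ (i - 1) * weyl_scale (of_nat i) f"
      by (simp add: commutator_power[OF zv] distrib_right weyl_scale_mult_left
          weyl_scale_mult_right flip: mult.assoc)
    moreover have "v ^ i * (z * f) \<in> ?T" "v ^ (i - 1) * weyl_scale (of_nat i) f \<in> ?T"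
      using f generated_inc[of z "{z}"] subalgebraD(5,6)[OF C]
      by (auto intro!: left_combinations_monomial[OF C])
    ultimately show "z * (v ^ i * f) \<in> ?T" by (simp add: left_combinations_add[OF C])
  qed
  have v_T: "v * x \<in> ?T" if "x \<in> ?T" for x
  proof (rule left_combinations_mult_left[OF C that])
    fix i f assume f: "f \<in> ?C"
    show "v * (v ^ i * f) \<in> ?T"
      using left_combinations_monomial[OF C f, of v "Suc i"] by (simp add: mult.assoc)
  qed
  have scale_T: "weyl_scale c x \<in> ?T" if "x \<in> ?T" for c x
  proof -
    have "weyl_scale c 1 * x \<in> ?T"
    proof (rule left_combinations_mult_left[OF C that])
      fix i f assume f: "f \<in> ?C"
      show "weyl_scale c 1 * (v ^ i * f) \<in> ?T"
        using left_combinations_monomial[OF C subalgebraD(5)[OF C f], of v i c]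
        by (simp add: weyl_scale_mult_left weyl_scale_mult_right)
    qed
    then show ?thesis by (simp add: weyl_scale_mult_left)
  qed
  have one_T: "1 \<in> ?T"
    using left_combinations_monomial[OF C subalgebraD(2)[OF C], of v 0] by simp
  have zero_T: "0 \<in> ?T"
    using left_combinations_monomial[OF C subalgebraD(1)[OF C], of v 0] by simp
  \<comment> \<open>Closure of \<open>?T\<close> under products is not evident; its left multipliers form a subalgebra anyway.\<close>
  have "subalgebra {x. \<forall>y\<in>?T. x * y \<in> ?T}"
    unfolding subalgebra_def weyl.subspace_def
    by (auto simp: zero_T distrib_right weyl_scale_mult_left mult.assoc
        left_combinations_add[OF C] scale_T)
  then have "generated_subalgebra {z, v} \<subseteq> {x. \<forall>y\<in>?T. x * y \<in> ?T}"
    by (rule generated_minimal[rotated]) (auto simp: z_T v_T)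
  then have all_T: "x \<in> ?T" for x
  proof -
    have "x * 1 \<in> ?T" using \<open>generated_subalgebra {z, v} \<subseteq> _\<close> gen one_T by blast
    then show ?thesis by simp
  qed
  define u where "u = w - v"
  have zu: "commutator z u = 0"
    using zv zw by (simp add: u_def commutator_def algebra_simps)
  obtain n f where f: "\<And>i. f i \<in> ?C" "u = (\<Sum>i<n. v ^ i * f i)"
    using all_T[of u] by (auto simp: left_combinations_def)
  have u_C: "u \<in> ?C"
  proof (cases n)
    case 0
    then show ?thesis using f subalgebraD(1)[OF C] by simp
  next
    case (Suc m)
    have "(\<Sum>i<m. v ^ i * weyl_scale (of_nat (Suc i)) (f (Suc i))) = 0"
      using commutator_left_combination[OF zv, of f m, OF f(1)] zu f(2) Suc by simp
    then have "weyl_scale (of_nat (Suc i)) (f (Suc i)) = 0" if "i < m" for i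
      using left_combination_eq_0[OF zv, of "\<lambda>i. weyl_scale (of_nat (Suc i)) (f (Suc i))" m i]
        that f(1) subalgebraD(5)[OF C] by blast
    then have "f (Suc i) = 0" if "i < m" for i
      using that by (simp add: weyl.scale_eq_0_iff del: of_nat_Suc)
    then have "u = f 0"
      unfolding f(2) Suc by (simp add: sum.lessThan_Suc_shift del: sum.lessThan_Suc)
    then show ?thesis using f(1) by simp
  qed
  let ?B = "generated_subalgebra {z, w}"
  note B = subalgebra_generated[of "{z, w}"]
  have zB: "z \<in> ?B" and wB: "w \<in> ?B" by (simp_all add: generated_inc)
  have "?C \<subseteq> ?B" by (rule generated_minimal[OF _ B]) (simp add: zB)
  then have "v \<in> ?B"
    using subalgebraD(4)[OF B wB, of u] u_C by (auto simp: u_def)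
  then have "generated_subalgebra {z, v} \<subseteq> ?B"
    using zB by (intro generated_minimal[OF _ B]) simp
  then show ?thesis using gen by blast
qed

text \<open>
A multiple of \<open>Q\<close> is a partner of \<open>z\<close>, and \<open>P\<close> is recovered from \<open>z\<close> and \<open>Q\<close>.
\<close>

lemma elementary_generates:
  fixes P Q z w :: "'k::field_char_0 weyl"
  assumes PQ: "commutator P Q = 1" and gen: "generated_subalgebra {P, Q} = UNIV"
    and z: "z = weyl_scale c P + weyl_scale d (Q ^ n)" "c \<noteq> 0" and zw: "commutator z w = 1"
  shows "generated_subalgebra {z, w} = UNIV"
proof (rule partner_generates[OF _ _ zw])
  let ?v = "weyl_scale (1 / c) Q"
  have "commutator z ?v = commutator P Q"
    using z(2) by (simp add: z(1) commutator_def distrib_left distrib_right weyl_scale_mult_left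
        weyl_scale_mult_right power_commutes weyl.scale_right_distrib)
  then show "commutator z ?v = 1" using PQ by simp
  let ?B = "generated_subalgebra {z, ?v}"
  note B = subalgebra_generated[of "{z, ?v}"]
  have zB: "z \<in> ?B" and vB: "?v \<in> ?B" by (simp_all add: generated_inc)
  have QB: "Q \<in> ?B" using subalgebraD(5)[OF B vB, of c] z(2) by simp
  have "weyl_scale (1 / c) (z - weyl_scale d (Q ^ n)) \<in> ?B"
    using subalgebraD(4,5)[OF B] zB subalgebra_power[OF B QB] by blast
  then have PB: "P \<in> ?B" using z by simp
  have "generated_subalgebra {P, Q} \<subseteq> ?B"
    using PB QB by (intro generated_minimal[OF _ B]) simp
  then show "?B = UNIV" using gen by blast
qed

text \<open>
The second form reduces to the first with \<open>q\<close>, \<open>-p\<close> in place of \<open>p\<close>, \<open>q\<close>.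
\<close>

lemma elementary_form_generates:
  fixes z w :: "'k::field_char_0 weyl"
  assumes zw: "commutator z w = 1" and "c \<noteq> 0"
    and z: "z = weyl_scale c weyl_p + weyl_scale d (weyl_q ^ n)
      \<or> z = weyl_scale c weyl_q + weyl_scale d (weyl_p ^ n)"
  shows "generated_subalgebra {z, w} = UNIV"
  using z
proof
  assume "z = weyl_scale c weyl_p + weyl_scale d (weyl_q ^ n)"
  then show ?thesis
    using elementary_generates[of weyl_p weyl_q z c d n w] generated_p_q assms(2) zw weyl_pq_relation
    by (simp add: commutator_def)
next
  assume z: "z = weyl_scale c weyl_q + weyl_scale d (weyl_p ^ n)"
  have 1: "commutator weyl_q (- weyl_p) = (1 :: 'k weyl)"
    using weyl_pq_relation by (simp add: commutator_def)
  let ?B = "generated_subalgebra {weyl_q, - weyl_p} :: 'k weyl set"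
  note B = subalgebra_generated[of "{weyl_q, - weyl_p} :: 'k weyl set"]
  have "0 - (- weyl_p) \<in> ?B"
    by (intro subalgebraD[OF B] generated_inc) simp
  then have "generated_subalgebra {weyl_p, weyl_q} \<subseteq> ?B"
    by (intro generated_minimal[OF _ B]) (simp add: generated_inc)
  then have 2: "?B = UNIV" by (simp add: generated_p_q top.extremum_unique)
  have neg: "(- weyl_p) ^ n = weyl_scale ((- 1) ^ n) (weyl_p ^ n :: 'k weyl)" for n
    by (induction n) (simp_all add: weyl_scale_mult_left weyl_scale_mult_right)
  have "z = weyl_scale c weyl_q + weyl_scale (d * (- 1) ^ n) ((- weyl_p) ^ n)"
    by (simp add: z neg flip: power_mult_distrib mult.assoc)
  from elementary_generates[OF 1 2 this assms(2) zw] show ?thesis .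
qed

section \<open>Elements with at most two homogeneous components\<close>

lemma symbol_two_terms_mult:
  fixes z u :: "'k::field_char_0 weyl"
  assumes z: "weyl_degrees z \<subseteq> {a, b}" and ab: "a \<noteq> b"
  shows "weyl_symbol (z * u) t
      = translate (t - a) (weyl_symbol z a) * weyl_symbol u (t - a)
      + translate (t - b) (weyl_symbol z b) * weyl_symbol u (t - b)" (is ?left)
    and "weyl_symbol (u * z) t
      = translate a (weyl_symbol u (t - a)) * weyl_symbol z a
      + translate b (weyl_symbol u (t - b)) * weyl_symbol z b" (is ?right)
proof -
  have super: "weyl_symbol (x * y) t
      = (\<Sum>s\<in>T. translate s (weyl_symbol x (t - s)) * weyl_symbol y s)"
    if "finite T" "\<And>s. s \<notin> T \<Longrightarrow> weyl_symbol x (t - s) = 0 \<or> weyl_symbol y s = 0"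
    for x y :: "'k weyl" and T
    unfolding symbol_mult
    by (rule sum.mono_neutral_cong[OF that(1) finite_symbol]) (use that(2) in auto)
  have "t - a \<noteq> t - b" using ab by simp
  moreover have "weyl_symbol z (t - s) = 0" if "s \<notin> {t - a, t - b}" for s
    using that by (intro weyl_degreesD[OF z]) auto
  ultimately show ?left using super[of "{t - a, t - b}" z u] by simp
  show ?right using super[of "{a, b}" u z] weyl_degreesD[OF z] ab by simp
qed

lemma symbol_two_terms_commutator:
  assumes z: "weyl_degrees z \<subseteq> {a, b}" and ab: "a \<noteq> b"
  shows "weyl_symbol (commutator z u) t
    = symbol_bracket (weyl_symbol z a) a (weyl_symbol u (t - a)) (t - a)
    + symbol_bracket (weyl_symbol z b) b (weyl_symbol u (t - b)) (t - b)"
  unfolding commutator_def symbol_diff symbol_bracket_def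
    symbol_two_terms_mult[OF z ab, of u t]
  by (simp add: algebra_simps)

text \<open>
The sizes of \<open>z\<close> and of the part of \<open>w\<close> in degree \<open>-a\<close> add up to \<open>2\<close>, and each is at least \<open>\<bar>a\<bar>\<close>.
\<close>

lemma one_degree_partner:
  assumes z: "weyl_degrees z \<subseteq> {a}" and zw: "commutator z w = 1"
  shows "\<bar>a\<bar> = 1 \<and> 2 * int (degree (weyl_symbol z a)) + a = 1"
proof -
  have bracket: "symbol_bracket (weyl_symbol z a) a (weyl_symbol w (- a)) (- a) = 1"
    using symbol_two_terms_commutator[of z a "a + 1" w 0] weyl_degreesD[OF z, of "a + 1"] z
    by (auto simp: zw symbol_one)
  then have nz: "weyl_symbol z a \<noteq> 0" "weyl_symbol w (- a) \<noteq> 0" by auto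
  show ?thesis
    using symbol_bracket_eq_1_degree[OF bracket] symbol_size[OF nz(1)] symbol_size[OF nz(2)]
    by linarith
qed

text \<open>
The lowest part of \<open>z^N\<close> is the \<open>N\<close>-th power of the lowest part of \<open>z\<close>.
\<close>

lemma symbol_two_terms_power:
  assumes z: "weyl_degrees z \<subseteq> {a, b}" and ab: "a < b"
    and za: "weyl_symbol z a \<noteq> 0"
  shows "(\<forall>t. weyl_symbol (z ^ N) t \<noteq> 0 \<longrightarrow> (\<exists>i\<le>N. t = int N * a + (b - a) * int i))
    \<and> weyl_symbol (z ^ N) (int N * a) \<noteq> 0"
proof (induction N)
  case 0
  then show ?case by (simp add: symbol_one)
next
  case (Suc N)
  have step: "weyl_symbol (z ^ Suc N) t
      = translate (t - a) (weyl_symbol z a) * weyl_symbol (z ^ N) (t - a)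
      + translate (t - b) (weyl_symbol z b) * weyl_symbol (z ^ N) (t - b)" for t
    using symbol_two_terms_mult(1)[OF z, of "z ^ N" t] ab by simp
  have "\<exists>i\<le>Suc N. t = int (Suc N) * a + (b - a) * int i" if nz: "weyl_symbol (z ^ Suc N) t \<noteq> 0" for t
  proof -
    consider "weyl_symbol (z ^ N) (t - a) \<noteq> 0" | "weyl_symbol (z ^ N) (t - b) \<noteq> 0"
      using nz unfolding step by fastforce
    then show ?thesis
    proof cases
      case 1
      then obtain i where "i \<le> N" "t - a = int N * a + (b - a) * int i" using Suc by blast
      then show ?thesis by (intro exI[of _ i]) (simp add: algebra_simps)
    next
      case 2
      then obtain i where "i \<le> N" "t - b = int N * a + (b - a) * int i" using Suc by blast
      then show ?thesis by (intro exI[of _ "Suc i"]) (simp add: algebra_simps)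
    qed
  qed
  moreover have below: "weyl_symbol (z ^ N) (int (Suc N) * a - b) = 0"
  proof (rule ccontr)
    assume "weyl_symbol (z ^ N) (int (Suc N) * a - b) \<noteq> 0"
    then obtain i where "int (Suc N) * a - b = int N * a + (b - a) * int i" using Suc by blast
    then have "(b - a) * (int i + 1) = 0" by (simp add: algebra_simps)
    then show False using ab by simp
  qed
  have "weyl_symbol (z ^ Suc N) (int (Suc N) * a) \<noteq> 0"
    unfolding step below using Suc za by (simp add: algebra_simps)
  ultimately show ?case by blast
qed

lemma two_term_ladder:
  assumes z: "weyl_degrees z \<subseteq> {a, b}" and ab: "a < b"
    and za: "weyl_symbol z a \<noteq> 0" and zb: "weyl_symbol z b \<noteq> 0" and zw: "commutator z w = 1"
  shows "symbol_ladder 1 a b (weyl_symbol z a) (weyl_symbol z b)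
    (\<lambda>j. weyl_symbol w ((b - a) * j - a))"
proof
  show "a < b" "weyl_symbol z a \<noteq> 0" "weyl_symbol z b \<noteq> 0" by fact+
  have "inj (\<lambda>j. (b - a) * j - a)" using ab by (simp add: inj_def)
  then show "finite {j. weyl_symbol w ((b - a) * j - a) \<noteq> 0}"
    using finite_vimageI[OF finite_symbol[of w]] by (simp add: vimage_def)
  show "symbol_bracket (weyl_symbol z a) a (weyl_symbol w ((b - a) * j - a)) ((b - a) * j - a)
      + symbol_bracket (weyl_symbol z b) b (weyl_symbol w ((b - a) * (j - 1) - a)) ((b - a) * (j - 1) - a)
      = (if j = 0 then 1 else 0)" for j
  proof -
    have "(b - a) * j - b = (b - a) * (j - 1) - a" by (simp add: algebra_simps)
    then show ?thesis
      using symbol_two_terms_commutator[OF z, of w "(b - a) * j"] ab by (simp add: zw symbol_one)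
  qed
  show "\<bar>a\<bar> \<le> 2 * int (degree (weyl_symbol z a)) + 1 * a"
    "\<bar>b\<bar> \<le> 2 * int (degree (weyl_symbol z b)) + 1 * b"
    using symbol_size[OF za] symbol_size[OF zb] by simp_all
  show "\<bar>(b - a) * j - a\<bar>
      \<le> 2 * int (degree (weyl_symbol w ((b - a) * j - a))) + 1 * ((b - a) * j - a)"
    if "weyl_symbol w ((b - a) * j - a) \<noteq> 0" for j
    using symbol_size[OF that] by simp
qed

text \<open>
As long as \<open>z\<close> is not of least possible size, the lowest rung and the lowest part of \<open>z^N\<close> both
commute with the lowest part of \<open>z\<close> and have the same degree, so they are proportional. Replacing \<open>w\<close> by
\<open>w - c z^N\<close> removes the lowest rung and adds none above the highest, as the parts of \<open>z^N\<close> cover the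
same \<open>N+1\<close> rungs.
\<close>

lemma minimal_size_by_descent:
  fixes z w :: "'k::field_char_0 weyl"
  assumes z: "weyl_degrees z \<subseteq> {a, b}"
    and za: "weyl_symbol z a \<noteq> 0" and zb: "weyl_symbol z b \<noteq> 0" and ab: "a < 0" "0 < b"
    and zw: "commutator z w = 1"
    and supp: "\<And>j. weyl_symbol w ((b - a) * j - a) \<noteq> 0 \<Longrightarrow> j0 \<le> j \<and> j < j0 + int M"
  shows "(a = - 1 \<or> b = 1) \<and> 2 * int (degree (weyl_symbol z a)) + a = - a
    \<and> 2 * int (degree (weyl_symbol z b)) + b = b"
  using zw supp
proof (induction M arbitrary: w j0 rule: less_induct)
  case (less M)
  let ?n = "\<lambda>j. (b - a) * j - a"
  have lt: "a < b" using ab by simp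
  interpret symbol_ladder 1 a b "weyl_symbol z a" "weyl_symbol z b" "\<lambda>j. weyl_symbol w (?n j)"
    by (rule two_term_ladder[OF z lt za zb less.prems(1)])
  show ?case
  proof (rule ccontr)
    assume not: "\<not> ?thesis"
    then obtain i0 N where i0: "i0 < 0" "weyl_symbol w (?n i0) \<noteq> 0"
        "weyl_symbol w (?n (i0 + int N)) \<noteq> 0" "?n i0 = int N * a"
      and between: "\<And>j. weyl_symbol w (?n j) \<noteq> 0 \<Longrightarrow> i0 \<le> j \<and> j \<le> i0 + int N"
      using straddling_ladder[OF ab] by auto
    have "N < M" using less.prems(2)[OF i0(2)] less.prems(2)[OF i0(3)] by linarith
    note power = symbol_two_terms_power[OF z lt za, of N]
    have bracket_w: "symbol_bracket (weyl_symbol z a) a (weyl_symbol w (int N * a)) (int N * a) = 0"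
    proof -
      have "weyl_symbol w (?n j) = 0" if "j < i0" for j using between[of j] that by force
      from lowest_rung_commutes[of i0, OF this i0(1)] show ?thesis unfolding i0(4) by simp
    qed
    have bracket_power:
      "symbol_bracket (weyl_symbol z a) a (weyl_symbol (z ^ N) (int N * a)) (int N * a) = 0"
    proof -
      have "weyl_symbol (z ^ N) (int N * a + a - b) = 0"
      proof (rule ccontr)
        assume "weyl_symbol (z ^ N) (int N * a + a - b) \<noteq> 0"
        then obtain i where "int N * a + a - b = int N * a + (b - a) * int i" using power by blast
        then have "(b - a) * (int i + 1) = 0" by (simp add: algebra_simps)
        then show False using lt by simp
      qed
      moreover have "commutator z (z ^ N) = 0" by (simp add: commutator_def power_commutes)
      ultimately show ?thesis
        using symbol_two_terms_commutator[OF z, of "z ^ N" "int N * a + a"] lt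
        by (simp add: symbol_zero)
    qed
    have "a \<noteq> 0" using ab by simp
    then obtain c where c: "weyl_symbol w (int N * a) = smult c (weyl_symbol (z ^ N) (int N * a))"
      using symbol_bracket_eq_0_unique[OF bracket_power bracket_w za] power by blast
    define w' where "w' = w - weyl_scale c (z ^ N)"
    have zw': "commutator z w' = 1"
      using less.prems(1) by (simp add: w'_def commutator_def right_diff_distrib left_diff_distrib
          weyl_scale_mult_left weyl_scale_mult_right power_commutes)
    have sym': "weyl_symbol w' t = weyl_symbol w t - smult c (weyl_symbol (z ^ N) t)" for t
      by (simp add: w'_def symbol_diff symbol_scale)
    have "i0 + 1 \<le> j \<and> j < i0 + 1 + int N" if nz: "weyl_symbol w' (?n j) \<noteq> 0" for j
    proof -
      have "j \<noteq> i0" using nz c by (auto simp: sym' i0(4))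
      moreover have "i0 \<le> j \<and> j \<le> i0 + int N"
      proof (cases "weyl_symbol w (?n j) = 0")
        case True
        then have "weyl_symbol (z ^ N) (?n j) \<noteq> 0" using nz by (auto simp: sym')
        then obtain i where i: "i \<le> N" "?n j = int N * a + (b - a) * int i" using power by blast
        then have "(b - a) * (j - i0) = (b - a) * int i" using i0(4) by (simp add: algebra_simps)
        then have "j - i0 = int i" using lt by simp
        then show ?thesis using i(1) by simp
      qed (use between in blast)
      ultimately show ?thesis by linarith
    qed
    from less.IH[OF \<open>N < M\<close> zw' this] show False using not by blast
  qed
qed

lemma two_degrees_have_minimal_size:
  fixes z w :: "'k::field_char_0 weyl"
  assumes z: "weyl_degrees z \<subseteq> {a, b}" and ab: "a < b"
    and za: "weyl_symbol z a \<noteq> 0" and zb: "weyl_symbol z b \<noteq> 0" and zw: "commutator z w = 1"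
    and nonconst: "degree (weyl_symbol z 0) = 0 \<Longrightarrow> weyl_symbol z 0 = 0"
  shows "a < 0 \<and> 0 < b \<and> (a = - 1 \<or> b = 1) \<and> 2 * int (degree (weyl_symbol z a)) + a = - a
    \<and> 2 * int (degree (weyl_symbol z b)) + b = b"
proof -
  interpret symbol_ladder 1 a b "weyl_symbol z a" "weyl_symbol z b"
      "\<lambda>j. weyl_symbol w ((b - a) * j - a)"
    by (rule two_term_ladder[OF z ab za zb zw])
  have a: "a < 0" using no_nonnegative_degrees nonconst za by fastforce
  have b: "0 < b" using no_nonpositive_degrees nonconst zb by fastforce
  let ?S = "{j. weyl_symbol w ((b - a) * j - a) \<noteq> 0}"
  \<comment> \<open>Any interval that contains the finitely many rungs starts the descent.\<close>
  define R where "R = Max (abs ` ?S)"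
  have "\<bar>j\<bar> \<le> R" if "j \<in> ?S" for j
    unfolding R_def using finite_rungs that by simp
  then have "- R \<le> j \<and> j < - R + int (nat (2 * R + 1))"
    if "weyl_symbol w ((b - a) * j - a) \<noteq> 0" for j
    using that by (force simp: abs_le_iff)
  from minimal_size_by_descent[OF z za zb a b zw this] show ?thesis using a b by simp
qed

text \<open>
The constant \<open>k\<close> accounts for a second homogeneous component that is a scalar.
\<close>

lemma one_degree_generates:
  fixes z w :: "'k::field_char_0 weyl"
  assumes z: "weyl_degrees (z - weyl_const k) \<subseteq> {a}" and zw: "commutator z w = 1"
  shows "generated_subalgebra {z, w} = UNIV"
proof -
  define y where "y = z - weyl_const k"
  have y: "weyl_degrees y \<subseteq> {a}" using z by (simp add: y_def)
  have yw: "commutator y w = 1"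
    using zw by (simp add: y_def commutator_def algebra_simps weyl_const_central)
  note size = one_degree_partner[OF y yw]
  obtain c where c: "weyl_symbol y a = smult c (weyl_symbol (extreme_monomial a) a)"
    using symbol_of_minimal_size[of y a] size by auto
  have "y = weyl_scale c (extreme_monomial a)"
  proof (rule symbol_eq_imp)
    show "weyl_symbol y t = weyl_symbol (weyl_scale c (extreme_monomial a)) t" for t
      by (cases "t = a") (simp_all add: c weyl_degreesD[OF y] symbol_scale symbol_extreme_monomial)
  qed
  moreover from this have "c \<noteq> 0" using yw by (auto simp: commutator_def)
  moreover have "z = y + weyl_scale k 1" by (simp add: y_def weyl_scale_def)
  moreover have "a = 1 \<or> a = - 1" using size by linarith
  ultimately show ?thesis
    by (intro elementary_form_generates[OF zw, of c k 0]) (auto simp: extreme_monomial_def)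
qed

lemma two_degrees_generate:
  fixes z w :: "'k::field_char_0 weyl"
  assumes z: "weyl_degrees z \<subseteq> {a, b}" and ab: "a < b"
    and zw: "commutator z w = 1"
  shows "generated_subalgebra {z, w} = UNIV"
proof (cases "weyl_symbol z a = 0 \<or> weyl_symbol z b = 0")
  case True
  then have "weyl_degrees z \<subseteq> {b} \<or> weyl_degrees z \<subseteq> {a}"
    using z by (auto simp: weyl_degrees_def)
  moreover have "weyl_const 0 = (0 :: 'k weyl)"
    using weyl.scale_zero_left[of 1] by (simp add: weyl_scale_def)
  ultimately show ?thesis
    using one_degree_generates[of z 0, OF _ zw] by auto
next
  case False
  show ?thesis
  proof (cases "weyl_symbol z 0 \<noteq> 0 \<and> degree (weyl_symbol z 0) = 0")
    case True
    then obtain k where k: "weyl_symbol z 0 = [:k:]" by (metis degree_eq_zeroE)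
    have "weyl_symbol (weyl_const k) t = (if t = 0 then [:k:] else 0)" for t
      using symbol_scale[of k 1 t] by (simp add: weyl_scale_def symbol_one)
    then have "weyl_symbol (z - weyl_const k) t = (if t = 0 then 0 else weyl_symbol z t)" for t
      by (simp add: symbol_diff k)
    moreover have "0 = a \<or> 0 = b" using True z by (auto simp: weyl_degrees_def)
    ultimately have "weyl_degrees (z - weyl_const k) \<subseteq> {b} \<or> weyl_degrees (z - weyl_const k) \<subseteq> {a}"
      using z by (auto simp: weyl_degrees_def split: if_splits)
    then show ?thesis using one_degree_generates[OF _ zw] by blast
  next
    case nonconst: False
    have cl: "a < 0" "0 < b" "a = - 1 \<or> b = 1"
        "2 * int (degree (weyl_symbol z a)) + a = - a" "2 * int (degree (weyl_symbol z b)) + b = b"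
      using two_degrees_have_minimal_size[OF z ab _ _ zw] False nonconst by auto
    obtain c where c: "weyl_symbol z a = smult c (weyl_symbol (extreme_monomial a) a)"
      using symbol_of_minimal_size[of z a] cl by auto
    obtain d where d: "weyl_symbol z b = smult d (weyl_symbol (extreme_monomial b) b)"
      using symbol_of_minimal_size[of z b] cl by auto
    have "z = weyl_scale c (extreme_monomial a) + weyl_scale d (extreme_monomial b)"
    proof (rule symbol_eq_imp)
      fix t
      consider "t = a" | "t = b" | "t \<noteq> a" "t \<noteq> b" by blast
      then show "weyl_symbol z t
          = weyl_symbol (weyl_scale c (extreme_monomial a) + weyl_scale d (extreme_monomial b)) t"
        using ab by cases (simp_all add: c d weyl_degreesD[OF z] symbol_add symbol_scale symbol_extreme_monomial)
    qed
    then have "z = weyl_scale c (weyl_p ^ nat (- a)) + weyl_scale d (weyl_q ^ nat b)"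
      using cl by (simp add: extreme_monomial_def)
    moreover have "c \<noteq> 0" "d \<noteq> 0" using False c d by auto
    ultimately show ?thesis
      using cl(3) elementary_form_generates[OF zw, of c d "nat b"]
        elementary_form_generates[OF zw, of d c "nat (- a)"]
      by (auto simp: add.commute)
  qed
qed

theorem theorem3p15:
  fixes z w :: "'k::field_char_0 weyl"
  assumes "commutator z w = 1"
    and "\<exists>hs. length hs \<le> 2 \<and> (\<forall>h\<in>set hs. homogeneous h) \<and> z = sum_list hs"
  shows "generated_subalgebra {z, w} = UNIV"
proof -
  obtain hs where hs: "length hs \<le> 2" "\<forall>h\<in>set hs. homogeneous h" "z = sum_list hs"
    using assms(2) by blast
  have "\<exists>a b. weyl_degrees z \<subseteq> {a, b}"
  proof -
    have "homogeneous (0 :: 'k weyl)"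
      unfolding homogeneous_def weyl_D_def by (blast intro: weyl.span_zero)
    moreover have "hs = [] \<or> (\<exists>x. hs = [x]) \<or> (\<exists>x y. hs = [x, y])"
      using hs(1) by (cases hs rule: remdups_adj.cases) auto
    ultimately obtain x y where "homogeneous x" "homogeneous y" and xy: "z = x + y"
      using hs(2,3) by fastforce
    then obtain a b where "x \<in> weyl_D a" "y \<in> weyl_D b" by (auto simp: homogeneous_def)
    then have "weyl_symbol z t = 0" if "t \<noteq> a" "t \<noteq> b" for t
      using symbol_weyl_D[of x a t] symbol_weyl_D[of y b t] that by (simp add: xy symbol_add)
    then have "weyl_degrees z \<subseteq> {a, b}" by (auto simp: weyl_degrees_def)
    then show ?thesis by blast
  qed
  then obtain a b where z: "weyl_degrees z \<subseteq> {a, b}" by blast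
  consider "a < b" | "b < a" | "a = b" by linarith
  then show ?thesis
  proof cases
    case 1
    then show ?thesis using two_degrees_generate[of z a b w] z assms(1) by blast
  next
    case 2
    then show ?thesis using two_degrees_generate[of z b a w] z assms(1) by blast
  next
    case 3
    then show ?thesis using two_degrees_generate[of z a "a + 1" w] z assms(1) by auto
  qed
qed

end
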